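(* For every fair division instance $\mathcal{I}=(N,M,\mathcal{V})$ in which all agents have additive valuations, and every real number $\alpha \le \frac{3}{4}+\frac{3}{3836}$, there exists an $\alpha$-MMS allocation of $\mathcal{I}$.
   Context: A fair division instance $\mathcal{I}=(N,M,\mathcal{V})$ consists of a set of agents $N=[n]$, a finite set $M$ of indivisible goods, and valuations $v_i:2^M\to\mathbb{R}_{\ge 0}$ for $i\in N$, which are additive: $v_i(S)=\sum_{g\in S}v_i(\{g\})$. For a valuation $v$, a set $S$ of goods and an integer $d\ge 1$, $\mathrm{MMS}^d_v(S)=\max_{(P_1,\dots,P_d)}\min_{j\in[d]}v(P_j)$, where the maximum ranges over all partitions of $S$ into $d$ (possibly empty) bundles. The maximin share of agent $i$ is $\mathrm{MMS}_i=\mathrm{MMS}^n_{v_i}(M)$. An allocation assigns to each agent $i$ a bundle $A_i\subseteq M$, the bundles being pairwise disjoint; it is $\alpha$-MMS if $v_i(A_i)\ge \alpha\cdot \mathrm{MMS}_i$ for every agent $i\in N$. *)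

theory Defs
  imports Complex_Main
begin

text \<open>Goods have type 'g; M is a finite set of goods. An additive valuation is given by
  its values on single goods, v :: 'g \<Rightarrow> real (nonnegative); the value of a bundle S is
  the sum of v over S.\<close>

definition additive_val :: "('g \<Rightarrow> real) \<Rightarrow> 'g set \<Rightarrow> real" where
  "additive_val v S = (\<Sum>g\<in>S. v g)"

definition partitions :: "nat \<Rightarrow> 'g set \<Rightarrow> (nat \<Rightarrow> 'g set) set" where
  "partitions d S = {P. (\<forall>j. j \<ge> d \<longrightarrow> P j = {}) \<and>
                        (\<Union>j<d. P j) = S \<and>
                        (\<forall>j<d. \<forall>k<d. j \<noteq> k \<longrightarrow> P j \<inter> P k = {})}"

definition MMS :: "nat \<Rightarrow> ('g \<Rightarrow> real) \<Rightarrow> 'g set \<Rightarrow> real" where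
  "MMS d v S = Max ((\<lambda>P. Min ((\<lambda>j. additive_val v (P j)) ` {..<d})) ` partitions d S)"

definition is_allocation :: "nat \<Rightarrow> 'g set \<Rightarrow> (nat \<Rightarrow> 'g set) \<Rightarrow> bool" where
  "is_allocation n M A \<longleftrightarrow> (\<forall>i<n. A i \<subseteq> M) \<and>
                            (\<forall>i<n. \<forall>k<n. i \<noteq> k \<longrightarrow> A i \<inter> A k = {})"

definition alpha_MMS :: "real \<Rightarrow> nat \<Rightarrow> 'g set \<Rightarrow> (nat \<Rightarrow> 'g \<Rightarrow> real) \<Rightarrow> (nat \<Rightarrow> 'g set) \<Rightarrow> bool" where
  "alpha_MMS \<alpha> n M v A \<longleftrightarrow> is_allocation n M A \<and>
     (\<forall>i<n. additive_val (v i) (A i) \<ge> \<alpha> * MMS n (v i) M)"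

end

theory Submission
  imports Defs "HOL-Library.Infinite_Set"
begin

text \<open>
  Sort the goods by value, so that all agents agree on the order, and scale every maximin share to 1.
  Let \<open>\<alpha> = 3/4 + \<delta>\<close> with \<open>\<delta> = 3/3836\<close>. As long as one of the sets \<open>{j(n-1)..jn}\<close>
  with \<open>j \<le> 3\<close> or \<open>{0, 2n}\<close> (counting goods from 0) is worth \<open>\<alpha>\<close> to somebody, she leaves
  with it. The maximin shares of the others never drop below \<open>1 - 4\<delta>\<close>, so after rescaling we are
  left with an instance in which none of these sets is worth \<open>\<beta> = 3/4 + d\<close> to anybody, where
  \<open>d = 4\<delta>/(1-4\<delta>) = 3/956\<close>.

  Such an instance is solved by bag filling: the top \<open>2n\<close> goods are paired to \<open>n\<close> bags, and
  bag after bag is filled with the remaining goods until somebody values it at \<open>\<beta>\<close>. If good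
  \<open>2n\<close> is worth at most \<open>1/4 - d\<close> to an agent, a filled bag is worth at most 1 to her; call
  the other agents tight. If at least a quarter of the agents are not tight, pair \<open>k\<close> with
  \<open>2n-1-k\<close> and prefer tight agents: a tight agent who got nothing has seen so many bags far below 1
  that goods cannot have run out, and for the others a pair worth more than 1 is made up for by the
  bundles of their partition. Otherwise pair \<open>k\<close> with \<open>n+k\<close> and prefer the agents that are
  not tight; since these are few, nearly all bags are worth less than \<open>\<beta>\<close> to them. For the tight
  agents this pairing has the advantage that the values of the pairs are monotone, hence pairs just below
  \<open>\<beta>\<close>, the only ones that can be filled to more than 1, look nearly alike. A weighting of the
  goods then gives every bundle of her partition weight at least 4, but every bag at most 4 on average.
\<close>

section \<open>Bag filling\<close>

text \<open>Each bag is closed at the least cut at which some unserved agent reaches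
  \<open>b\<close>, so without its last added good it is below \<open>b\<close> for everyone left
  unserved. Since members of \<open>Q\<close> win ties, an unserved member of \<open>Q\<close>
  values below \<open>b\<close> every bag that went outside \<open>Q\<close>. The second alternative
  records the moment when the goods run out at bag \<open>s\<close>.\<close>

lemma bag_filling:
  fixes base :: "nat \<Rightarrow> nat \<Rightarrow> real" and w :: "nat \<Rightarrow> nat \<Rightarrow> real" and b :: real
  assumes m0: "m0 \<le> m"
  shows "(\<exists>\<sigma> c. inj_on \<sigma> {..<n} \<and> \<sigma> ` {..<n} \<subseteq> {..<n} \<and> (\<forall>k. c k \<le> c (Suc k)) \<and> c 0 = m0 \<and> c n \<le> m \<and>
            (\<forall>k<n. b \<le> base (\<sigma> k) k + sum (w (\<sigma> k)) {c k..<c (Suc k)}))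
    \<or> (\<exists>\<sigma> c s i. s < n \<and> i < n \<and> inj_on \<sigma> {..<s} \<and> \<sigma> ` {..<s} \<subseteq> {..<n} \<and> i \<notin> \<sigma> ` {..<s} \<and>
            (\<forall>k. c k \<le> c (Suc k)) \<and> c 0 = m0 \<and> (\<forall>k>s. c k = m) \<and>
            (\<forall>k<s. c k < c (Suc k) \<longrightarrow> base i k + sum (w i) {c k..<c (Suc k) - 1} < b) \<and>
            base i s + sum (w i) {c s..<c (Suc s)} < b \<and>
            (i \<in> Q \<longrightarrow> (\<forall>k<s. \<sigma> k \<notin> Q \<longrightarrow> base i k + sum (w i) {c k..<c (Suc k)} < b)))"
    (is "_ \<or> ?stuck")
proof -
  define state where "state s \<sigma> c \<longleftrightarrow> inj_on \<sigma> {..<s} \<and> \<sigma> ` {..<s} \<subseteq> {..<n} \<and> (\<forall>k. c k \<le> c (Suc k)) \<and>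
      c 0 = m0 \<and> c s \<le> m \<and> (\<forall>k<s. b \<le> base (\<sigma> k) k + sum (w (\<sigma> k)) {c k..<c (Suc k)}) \<and>
      (\<forall>i<n. i \<notin> \<sigma> ` {..<s} \<longrightarrow>
         (\<forall>k<s. c k < c (Suc k) \<longrightarrow> base i k + sum (w i) {c k..<c (Suc k) - 1} < b) \<and>
         (i \<in> Q \<longrightarrow> (\<forall>k<s. \<sigma> k \<notin> Q \<longrightarrow> base i k + sum (w i) {c k..<c (Suc k)} < b)))"
    for s :: nat and \<sigma> c :: "nat \<Rightarrow> nat"
  have "s \<le> n \<Longrightarrow> ?stuck \<or> (\<exists>\<sigma> c. state s \<sigma> c)" for s
  proof (induction s)
    case 0
    have "state 0 id (\<lambda>_. m0)" using m0 by (simp add: state_def)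
    then show ?case by blast
  next
    case (Suc s)
    show ?case
    proof (cases ?stuck)
      case False
      have "s \<le> n" using Suc.prems by simp
      from Suc.IH[OF this] obtain \<sigma> c where st: "state s \<sigma> c" by (elim disjE) (use False in blast)+
      have inj: "inj_on \<sigma> {..<s}" and ran: "\<sigma> ` {..<s} \<subseteq> {..<n}" and cm: "\<And>k. c k \<le> c (Suc k)"
        and c0: "c 0 = m0" and cs: "c s \<le> m"
        and sat: "\<And>k. k < s \<Longrightarrow> b \<le> base (\<sigma> k) k + sum (w (\<sigma> k)) {c k..<c (Suc k)}"
        and low: "\<And>i k. i < n \<Longrightarrow> i \<notin> \<sigma> ` {..<s} \<Longrightarrow> k < s \<Longrightarrow> c k < c (Suc k) \<Longrightarrow>
                   base i k + sum (w i) {c k..<c (Suc k) - 1} < b"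
        and pri: "\<And>i k. i < n \<Longrightarrow> i \<notin> \<sigma> ` {..<s} \<Longrightarrow> i \<in> Q \<Longrightarrow> k < s \<Longrightarrow> \<sigma> k \<notin> Q \<Longrightarrow>
                   base i k + sum (w i) {c k..<c (Suc k)} < b"
        using st unfolding state_def by auto
      define U where "U = {..<n} - \<sigma> ` {..<s}"
      define ok where "ok e i \<longleftrightarrow> b \<le> base i s + sum (w i) {c s..<e}" for e i
      have "card (\<sigma> ` {..<s}) < card {..<n}"
        using Suc.prems card_image_le[of "{..<s}" \<sigma>] by simp
      then have "\<not> {..<n} \<subseteq> \<sigma> ` {..<s}"
        by (meson card_mono finite_imageI finite_lessThan not_le)
      then have Une: "U \<noteq> {}" unfolding U_def by blast
      have "\<exists>e. c s \<le> e \<and> e \<le> m \<and> (\<exists>i\<in>U. ok e i)"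
      proof (rule ccontr)
        assume no: "\<not> ?thesis"
        obtain i where i: "i \<in> U" using Une by auto
        \<comment> \<open>The unfinished bag \<open>s\<close> absorbs all remaining goods and later
          bags get none, so that the bags still exhaust the goods.\<close>
        define c' where "c' k = (if k \<le> s then c k else m)" for k
        have nok: "\<not> ok m i" using no i cs by auto
        have "?stuck"
        proof (intro exI conjI)
          show "s < n" using Suc.prems by simp
          show "i < n" "i \<notin> \<sigma> ` {..<s}" using i by (auto simp: U_def)
          show "\<forall>k. c' k \<le> c' (Suc k)" 
          proof
            fix k show "c' k \<le> c' (Suc k)" using cm[of k] cs by (cases "k < s"; cases "k = s") (auto simp: c'_def)
          qed
          show "c' 0 = m0" using c0 by (simp add: c'_def)
          show "\<forall>k>s. c' k = m" by (simp add: c'_def)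
          show "\<forall>k<s. c' k < c' (Suc k) \<longrightarrow> base i k + sum (w i) {c' k..<c' (Suc k) - 1} < b"
            using low i by (auto simp: c'_def U_def)
          show "base i s + sum (w i) {c' s..<c' (Suc s)} < b"
            using nok by (simp add: ok_def c'_def)
          show "i \<in> Q \<longrightarrow> (\<forall>k<s. \<sigma> k \<notin> Q \<longrightarrow> base i k + sum (w i) {c' k..<c' (Suc k)} < b)"
            using pri i by (auto simp: c'_def U_def)
        qed (fact inj ran)+
        with False show False by blast
      qed
      then obtain e0 where e0: "c s \<le> e0 \<and> e0 \<le> m \<and> (\<exists>i\<in>U. ok e0 i)" by blast
      define e where "e = (LEAST e. c s \<le> e \<and> e \<le> m \<and> (\<exists>i\<in>U. ok e i))"
      have e: "c s \<le> e" "e \<le> m" "\<exists>i\<in>U. ok e i"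
        using LeastI[of "\<lambda>e. c s \<le> e \<and> e \<le> m \<and> (\<exists>i\<in>U. ok e i)", OF e0] unfolding e_def by blast+
      have least: "\<not> ok (e - 1) i" if "c s < e" "i \<in> U" for i
      proof
        assume "ok (e - 1) i"
        then have "c s \<le> e - 1 \<and> e - 1 \<le> m \<and> (\<exists>i\<in>U. ok (e - 1) i)" using that e by auto
        then have "e \<le> e - 1" unfolding e_def by (rule Least_le)
        with that show False by simp
      qed
      \<comment> \<open>A satisfied agent from \<open>Q\<close> is taken whenever there is
        one.\<close>
      obtain j where j: "j \<in> U" "ok e j" and jQ: "\<And>i. i \<in> U \<Longrightarrow> i \<in> Q \<Longrightarrow> ok e i \<Longrightarrow> j \<in> Q"
        using e(3) by blast
      define c' where "c' k = (if k \<le> s then c k else e)" for k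
      define \<sigma>' where "\<sigma>' = \<sigma>(s := j)"
      have im: "\<sigma>' ` {..<Suc s} = insert j (\<sigma> ` {..<s})" by (auto simp: \<sigma>'_def lessThan_Suc)
      have "state (Suc s) \<sigma>' c'"
        unfolding state_def
      proof (intro conjI allI impI)
        show "inj_on \<sigma>' {..<Suc s}"
          using inj j(1) by (auto simp: \<sigma>'_def U_def lessThan_Suc inj_on_def)
        show "\<sigma>' ` {..<Suc s} \<subseteq> {..<n}" unfolding im using ran j by (auto simp: U_def)
        show "c' k \<le> c' (Suc k)" for k
          using cm[of k] e(1) by (cases "k < s"; cases "k = s") (auto simp: c'_def)
        show "c' 0 = m0" using c0 by (simp add: c'_def)
        show "c' (Suc s) \<le> m" using e by (simp add: c'_def)
        show "b \<le> base (\<sigma>' k) k + sum (w (\<sigma>' k)) {c' k..<c' (Suc k)}" if "k < Suc s" for k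
          using that sat[of k] j(2) by (cases "k = s") (auto simp: \<sigma>'_def c'_def ok_def)
        show "base i k + sum (w i) {c' k..<c' (Suc k) - 1} < b"
          if "i < n" "i \<notin> \<sigma>' ` {..<Suc s}" "k < Suc s" "c' k < c' (Suc k)" for i k
        proof -
          have iU: "i \<in> U" "i \<notin> \<sigma> ` {..<s}" using that im by (auto simp: U_def)
          show ?thesis using that low[of i k] iU least[of i]
            by (cases "k = s") (auto simp: c'_def ok_def)
        qed
        show "base i k + sum (w i) {c' k..<c' (Suc k)} < b"
          if "i < n" "i \<notin> \<sigma>' ` {..<Suc s}" "i \<in> Q" "k < Suc s" "\<sigma>' k \<notin> Q" for i k
        proof -
          have iU: "i \<in> U" "i \<notin> \<sigma> ` {..<s}" using that im by (auto simp: U_def)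
          show ?thesis using that pri[of i k] iU jQ[of i]
            by (cases "k = s") (auto simp: c'_def \<sigma>'_def ok_def)
        qed
      qed
      then show ?thesis by blast
    qed simp
  qed
  from this[of n] show ?thesis unfolding state_def by blast
qed

section \<open>Sums over bags and over bundles\<close>

lemma sum_consecutive_intervals:
  fixes f :: "nat \<Rightarrow> real"
  assumes "\<And>k. c k \<le> c (Suc k)"
  shows "(\<Sum>k<n. sum f {c k..<c (Suc k)}) = sum f {c 0..<c n}"
proof (induction n)
  case (Suc n)
  have "c 0 \<le> c n" using assms lift_Suc_mono_le[of c 0 n] by simp
  then show ?case using Suc assms[of n] by (simp add: sum.atLeastLessThan_concat)
qed simp

lemma sum_bags:
  fixes f :: "nat \<Rightarrow> real"
  assumes c: "\<And>k. c k \<le> c (Suc k)" and c0: "c 0 = 2 * n" and cn: "c n = m"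
    and g: "bij_betw g {..<n} {n..<2 * n}"
  shows "sum f {..<m} = (\<Sum>k<n. f k + f (g k) + sum f {c k..<c (Suc k)})"
proof -
  have "c 0 \<le> c n" using c lift_Suc_mono_le[of c 0 n] by simp
  then have m: "2 * n \<le> m" using c0 cn by simp
  have "sum f {..<m} = sum f {..<n} + sum f {n..<2*n} + sum f {2*n..<m}"
    using m sum.atLeastLessThan_concat[of 0 n "2*n" f] sum.atLeastLessThan_concat[of 0 "2*n" m f]
    by (simp add: lessThan_atLeast0)
  also have "sum f {n..<2*n} = (\<Sum>k<n. f (g k))"
    using sum.reindex_bij_betw[OF g, of f] by simp
  also have "sum f {2*n..<m} = (\<Sum>k<n. sum f {c k..<c (Suc k)})"
    using sum_consecutive_intervals[of c f n, OF c] c0 cn by simp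
  finally show ?thesis by (simp add: sum.distrib)
qed

lemma sum_bundles:
  fixes f :: "nat \<Rightarrow> real" and \<pi> :: "nat \<Rightarrow> nat"
  assumes "\<And>g. g < m \<Longrightarrow> \<pi> g < n"
  shows "sum f {..<m} = (\<Sum>j<n. sum f {g. g < m \<and> \<pi> g = j})"
proof -
  have "sum f {..<m} = (\<Sum>j<n. sum f {g \<in> {..<m}. \<pi> g = j})"
    by (rule sum.group[symmetric]) (use assms in auto)
  then show ?thesis by simp
qed

lemma sum_split_last:
  fixes f :: "nat \<Rightarrow> real"
  assumes "a < b"
  shows "sum f {a..<b} = sum f {a..<b - 1} + f (b - 1)"
  using assms sum.atLeastLessThan_Suc[of a "b - 1" f] by simp

lemma bij_mirror:
  fixes n :: nat
  shows "bij_betw (\<lambda>k. 2 * n - 1 - k) {..<n} {n..<2 * n}"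
  by (rule bij_betw_byWitness[where f' = "\<lambda>k. 2 * n - 1 - k"]) auto

lemma bij_shift:
  fixes n :: nat
  shows "bij_betw (\<lambda>k. n + k) {..<n} {n..<2 * n}"
  by (rule bij_betw_byWitness[where f' = "\<lambda>k. k - n"]) auto

lemma sum_two_level:
  fixes f :: "nat \<Rightarrow> real" and hi lo :: real
  assumes "\<And>k. k < n \<Longrightarrow> f k \<le> (if k \<in> S then hi else lo)" and "S \<subseteq> {..<n}"
  shows "sum f {..<n} \<le> card S * hi + (real n - card S) * lo"
proof -
  have fS: "finite S" "card S \<le> n" using assms(2) finite_subset card_mono[of "{..<n}" S] by auto
  have "sum f {..<n} = sum f S + sum f ({..<n} - S)"
    using sum.subset_diff[OF assms(2), of f] by simp
  also have "\<dots> \<le> (\<Sum>k\<in>S. hi) + (\<Sum>k\<in>{..<n} - S. lo)"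
    by (intro add_mono sum_mono) (use assms in force)+
  finally show ?thesis using fS assms(2) by (simp add: card_Diff_subset of_nat_diff)
qed

section \<open>Weights of bundles\<close>

text \<open>A bundle of value 1 is described by the numbers \<open>a\<close>, \<open>b\<close>, \<open>r\<close> of its goods of three
  kinds. Its weight is bounded from below in two ways: by counting, or by its value minus a loss
  per good; for all \<open>a\<close>, \<open>b\<close>, \<open>r\<close> one of the two bounds gives 4.\<close>

lemma slot_count:
  fixes \<alpha>A \<alpha>B \<gamma> lA lB lQ e :: real and a b r :: nat
  assumes g: "1 \<le> \<gamma>" and s: "\<alpha>A + \<alpha>B + \<gamma> = 4" and AB: "\<alpha>B \<le> \<alpha>A" and Bg: "\<gamma> \<le> \<alpha>B"
    and Q0: "0 \<le> lQ" and e0: "0 \<le> e"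
    and AQQ: "4 \<le> \<alpha>A + \<gamma> + \<gamma> \<or> lA + lQ + lQ \<le> e" and AQ: "lA + lQ \<le> e"
    and AA: "4 \<le> \<alpha>A + \<alpha>A \<or> lA + lA \<le> e" and ABl: "lA + lB \<le> e"
    and BBB: "4 \<le> \<alpha>B + \<alpha>B + \<alpha>B \<or> lB + lB + lB \<le> e"
    and BBQ: "4 \<le> \<alpha>B + \<alpha>B + \<gamma> \<or> lB + lB + lQ \<le> e"
    and BB: "lB + lB \<le> e" and BQQ: "lB + lQ + lQ \<le> e" and QQQ: "lQ + lQ + lQ \<le> e"
  shows "4 \<le> a * \<alpha>A + b * \<alpha>B + r * \<gamma> \<or> a * lA + b * lB + r * lQ \<le> e"
proof -
  have pos: "0 \<le> \<alpha>A" "0 \<le> \<alpha>B" "0 \<le> \<gamma>" using assms by auto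
  have br: "real (b + r) * \<gamma> \<le> b * \<alpha>B + r * \<gamma>"
    using Bg mult_left_mono[of \<gamma> \<alpha>B "real b"] by (simp add: algebra_simps)
  have brk: "real k * \<gamma> \<le> b * \<alpha>B + r * \<gamma>" if "k \<le> b + r" for k
  proof -
    have "real k * \<gamma> \<le> real (b + r) * \<gamma>" using that pos by (intro mult_right_mono) auto
    with br show ?thesis by linarith
  qed
  have nn: "0 \<le> b * \<alpha>B + r * \<gamma>" using brk[of 0] by simp
  \<comment> \<open>Counting succeeds with four goods, as \<open>1 \<le> \<gamma>\<close>, and with
    any three that dominate one good of each kind, by \<open>s\<close>. The remaining combinations
    are those covered by the assumptions from \<open>AQQ\<close> to \<open>QQQ\<close>.\<close>
  consider "a = 0" | "a = 1" | "a = 2" | "a \<ge> 3" by linarith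
  then show ?thesis
  proof cases
    case 1
    show ?thesis
    proof (cases "b + r \<ge> 4")
      case True
      then show ?thesis using brk[of 4] g 1 by auto
    next
      case False
      then consider "b = 0" "r \<le> 3" | "b = 1" "r \<le> 2" | "b = 2" "r = 0" | "b = 2" "r = 1" | "b = 3" "r = 0"
        by linarith
      then show ?thesis
      proof cases
        case c: 1
        have "real r * lQ \<le> 3 * lQ" using c Q0 by (intro mult_right_mono) auto
        then show ?thesis using 1 c QQQ by simp
      next
        case c: 2
        have "real r * lQ \<le> 2 * lQ" using c Q0 by (intro mult_right_mono) auto
        then show ?thesis using 1 c BQQ by simp
      qed (use 1 BBB BBQ BB in auto)
    qed
  next
    case 2
    show ?thesis
    proof (cases "b = 0")
      case True
      consider "r = 0" | "r = 1" | "r = 2" | "r \<ge> 3" by linarith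
      then show ?thesis
      proof cases
        case 4
        then have "3 * \<gamma> \<le> r * \<gamma>" using pos by (intro mult_right_mono) auto
        moreover have "real a * \<alpha>A = \<alpha>A" "real b * \<alpha>B = 0" using 2 True by simp_all
        ultimately show ?thesis using g Bg AB by linarith
      qed (use 2 True AQQ AQ Q0 in auto)
    next
      case b: False
      show ?thesis
      proof (cases "b + r \<ge> 2")
        case True
        have "real (b - 1 + r) * \<gamma> \<le> real (b - 1) * \<alpha>B + r * \<gamma>"
          using Bg mult_left_mono[of \<gamma> \<alpha>B "real (b - 1)"] by (simp add: algebra_simps)
        moreover have "1 * \<gamma> \<le> real (b - 1 + r) * \<gamma>"
          using True pos b by (intro mult_right_mono) auto
        moreover have "b * \<alpha>B = \<alpha>B + real (b - 1) * \<alpha>B" using b by (simp add: algebra_simps of_nat_diff)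
        ultimately show ?thesis using s 2 by simp
      next
        case False
        with b have "b = 1" "r = 0" by auto
        then show ?thesis using 2 ABl by simp
      qed
    qed
  next
    case 3
    then show ?thesis using AA brk[of 1] s AB nn by (cases "b + r = 0") auto
  next
    case 4
    have "3 * \<alpha>A \<le> a * \<alpha>A" using 4 pos by (intro mult_right_mono) auto
    then show ?thesis using nn s AB Bg by linarith
  qed
qed

text \<open>\<open>U\<close> and \<open>L\<close> bound the two goods of the critical pairs, those whose value lies just below
  the threshold. Weights proportional to value would be wasteful there, so the goods of critical pairs
  get constant weights \<open>\<alpha>A\<close> and \<open>\<alpha>B\<close> that leave exactly \<open>\<gamma>\<close> for a third good. The
  constants interpolate between the shapes (1/2, 1/4, 1/4) and (3/8, 3/8, 1/4).\<close>

lemma slot_parameters: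
  fixes U L :: real
  assumes UL: "U + L \<le> 180/239" and U: "U \<le> 121/239" and L: "L \<le> 90/239"
  obtains \<gamma> \<alpha>A \<alpha>B lQ :: real where
    "1 \<le> \<gamma>" "\<gamma> \<le> 240/239" "\<alpha>A + \<alpha>B + \<gamma> = 4" "\<gamma> \<le> \<alpha>B" "\<gamma> \<le> \<alpha>A"
    "1057/1000 * (240/239) - \<gamma> \<le> lQ" "57/1000 * (236/239) \<le> lQ"
    "\<And>(a::nat) (b::nat) (r::nat). 4 \<le> a * \<alpha>A + b * \<alpha>B + r * \<gamma> \<or>
       a * (1057/250 * U - \<alpha>A) + b * (1057/250 * L - \<alpha>B) + r * lQ \<le> 57/250"
proof -
  \<comment> \<open>As \<open>h\<close> grows from 0, \<open>\<gamma>\<close> rises to its cap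
    240/239, reached at \<open>h = 1/478\<close>. Beyond that \<open>\<alpha>B\<close> grows at the
    expense of \<open>\<alpha>A\<close> until both are equal.\<close>
  define h where "h = 1/2 - U"
  have Uh: "U = 1/2 - h" by (simp add: h_def)
  consider "h \<le> 0" | "0 \<le> h" "h \<le> 1/478" | "1/478 \<le> h" by linarith
  then show ?thesis
  proof cases
    case 1
    have slots: "4 \<le> real a * 2 + real b * 1 + real r * 1 \<or>
         real a * (1057/250 * U - 2) + real b * (1057/250 * L - 1) +
         real r * (1057/1000 * (240/239) - 1) \<le> 57/250" for a b r :: nat
        by (insert assms 1 Uh, rule slot_count) argo+
    show ?thesis
      by (rule that[of 1 2 1 "1057/1000 * (240/239) - 1"]; (rule slots | simp))
  next
    case 2
    have slots: "4 \<le> real a * (2 - 4*h) + real b * (1 + 2*h) + real r * (1 + 2*h) \<or>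
         real a * (1057/250 * U - (2 - 4*h)) + real b * (1057/250 * L - (1 + 2*h)) +
         real r * (1057/1000 * (240/239) - 1) \<le> 57/250" for a b r :: nat
        by (insert assms 2 Uh, rule slot_count) argo+
    show ?thesis
      by (insert 2, rule that[of "1 + 2*h" "2 - 4*h" "1 + 2*h" "1057/1000 * (240/239) - 1"]) (rule slots | argo)+
  next
    case 3
    \<comment> \<open>The largest weight of the second kind for which one good of the first kind and
      two of the third lose at most 57/250 together.\<close>
    define aB where "aB = 1 - 1/239 + 1057/250 * h - 2 * (57/1000) / 239"
    show ?thesis
    proof (cases "aB \<le> (3 - 1/239) / 2")
      case True
      have slots: "4 \<le> real a * (3 - 1/239 - aB) + real b * aB + real r * (240/239) \<or>
           real a * (1057/250 * U - (3 - 1/239 - aB)) + real b * (1057/250 * L - aB) +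
           real r * (57/1000 * (240/239)) \<le> 57/250" for a b r :: nat
          by (insert assms 3 Uh True aB_def, rule slot_count) argo+
      show ?thesis
        by (insert 3 True aB_def, rule that[of "240/239" "3 - 1/239 - aB" aB "57/1000 * (240/239)"]) (rule slots | argo)+
    next
      case False
      have slots: "4 \<le> real a * ((3 - 1/239) / 2) + real b * ((3 - 1/239) / 2) + real r * (240/239) \<or>
           real a * (1057/250 * U - (3 - 1/239) / 2) + real b * (1057/250 * L - (3 - 1/239) / 2) +
           real r * (57/1000 * (240/239)) \<le> 57/250" for a b r :: nat
          by (insert assms 3 Uh False aB_def, rule slot_count) argo+
      show ?thesis
        by (rule that[of "240/239" "(3 - 1/239) / 2" "(3 - 1/239) / 2" "57/1000 * (240/239)"]; (rule slots | simp))
    qed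
  qed
qed

lemma sum_if_const:
  fixes x :: real
  assumes "finite S"
  shows "(\<Sum>g\<in>S. if P g then x else 0) = real (card {g \<in> S. P g}) * x"
  using assms by (simp flip: sum.inter_filter)

text \<open>Types 0, 1, 2 are the kinds counted in \<open>slots\<close>. A good of type 3 or more
  has at least its proportional weight \<open>e * w g\<close>, hence no loss, and does not enter the
  counts. As the bundle is worth 1, a total loss of \<open>e - 4\<close> still leaves weight
  4.\<close>

lemma bundle_weight:
  fixes w W :: "nat \<Rightarrow> real" and ty :: "nat \<Rightarrow> nat"
  assumes fin: "finite S" and one: "sum w S = 1"
    and A: "\<And>g. g \<in> S \<Longrightarrow> ty g = 0 \<Longrightarrow> \<alpha>A \<le> W g \<and> e * w g - lA \<le> W g"
    and B: "\<And>g. g \<in> S \<Longrightarrow> ty g = 1 \<Longrightarrow> \<alpha>B \<le> W g \<and> e * w g - lB \<le> W g"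
    and R: "\<And>g. g \<in> S \<Longrightarrow> ty g = 2 \<Longrightarrow> \<gamma> \<le> W g \<and> e * w g - lQ \<le> W g"
    and Z: "\<And>g. g \<in> S \<Longrightarrow> 3 \<le> ty g \<Longrightarrow> 0 \<le> W g \<and> e * w g \<le> W g"
    and slots: "\<And>(a::nat) (b::nat) (r::nat). 4 \<le> a * \<alpha>A + b * \<alpha>B + r * \<gamma> \<or> a * lA + b * lB + r * lQ \<le> e - 4"
  shows "4 \<le> sum W S"
proof -
  define n where "n t = card {g \<in> S. ty g = t}" for t
  let ?f = "\<lambda>x y z g. (if ty g = 0 then x else 0) + (if ty g = 1 then y else 0) + (if ty g = 2 then z else (0::real))"
  have f: "sum (?f x y z) S = n 0 * x + n 1 * y + n 2 * z" for x y z :: real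
    unfolding sum.distrib sum_if_const[OF fin] n_def ..
  have ty: "ty g = 0 \<or> ty g = 1 \<or> ty g = 2 \<or> 3 \<le> ty g" for g by linarith
  have "sum (?f \<alpha>A \<alpha>B \<gamma>) S \<le> sum W S"
    by (rule sum_mono) (use ty A B R Z in fastforce)
  moreover have "sum (\<lambda>g. e * w g - ?f lA lB lQ g) S \<le> sum W S"
    by (rule sum_mono) (use ty A B R Z in fastforce)
  then have "e * sum w S - sum (?f lA lB lQ) S \<le> sum W S"
    by (simp only: sum_subtractf sum_distrib_left)
  ultimately show ?thesis using slots[of "n 0" "n 1" "n 2"] one unfolding f by auto
qed

section \<open>Agents in an irreducible instance\<close>

text \<open>The view of one agent on an irreducible instance in which goods are sorted and every bundle of her
  partition has value exactly 1. With \<open>d = 3/956\<close> the threshold is \<open>3/4 + d = 180/239\<close>,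
  and \<open>1/4 - d = 59/239\<close>, \<open>1/4 + d/3 = 60/239\<close>, \<open>1/2 + 2d = 121/239\<close>.\<close>

locale ordered_agent =
  fixes n m :: nat and w :: "nat \<Rightarrow> real" and \<pi> :: "nat \<Rightarrow> nat"
  assumes n_pos: "1 \<le> n" and m_large: "3 * n < m"
    and anti: "i \<le> j \<Longrightarrow> w j \<le> w i" and nonneg: "0 \<le> w g"
    and label: "g < m \<Longrightarrow> \<pi> g < n" and unit: "j < n \<Longrightarrow> sum w {g. g < m \<and> \<pi> g = j} = 1"
    and r1: "w (n - 1) + w n < 180/239"
    and r2: "w (2 * n - 2) + w (2 * n - 1) + w (2 * n) < 180/239"
    and r3: "w (3 * n - 3) + w (3 * n - 2) + w (3 * n - 1) + w (3 * n) < 180/239"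
    and r4: "w 0 + w (2 * n) < 180/239"
begin

lemma value_n: "w n < 90/239"
  using r1 anti[of "n - 1" n] by simp

lemma value_2n: "w (2 * n) < 60/239"
  using r2 anti[of "2 * n - 2" "2 * n"] anti[of "2 * n - 1" "2 * n"] by simp

lemma value_3n: "w (3 * n) < 45/239"
  using r3 anti[of "3 * n - 3" "3 * n"] anti[of "3 * n - 2" "3 * n"] anti[of "3 * n - 1" "3 * n"] by simp

lemma total: "sum w {..<m} = n"
  using sum_bundles[of m \<pi> n w] label unit by simp

end

text \<open>The bags \<open>{k, g k}\<close> were filled in order, bag \<open>k\<close> with the goods
  \<open>{c k..<c (Suc k)}\<close>, until the goods ran out at bag \<open>s\<close>, for an agent who received nothing.\<close>

definition stuck_bags :: "(nat \<Rightarrow> real) \<Rightarrow> nat \<Rightarrow> nat \<Rightarrow> (nat \<Rightarrow> nat) \<Rightarrow> (nat \<Rightarrow> nat) \<Rightarrow> nat \<Rightarrow> bool" where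
  "stuck_bags w n m g c s \<longleftrightarrow> s < n \<and> (\<forall>k. c k \<le> c (Suc k)) \<and> c 0 = 2 * n \<and> (\<forall>k>s. c k = m) \<and>
     (\<forall>k<s. c k < c (Suc k) \<longrightarrow> w k + w (g k) + sum w {c k..<c (Suc k) - 1} < 180/239) \<and>
     w s + w (g s) + sum w {c s..<c (Suc s)} < 180/239"

context ordered_agent
begin

lemma stuck_bagsD:
  assumes "stuck_bags w n m g c s"
  shows "s < n" "\<And>k. c k \<le> c (Suc k)" "c 0 = 2 * n" "c n = m" "\<And>k. 2 * n \<le> c k"
    "\<And>k. s < k \<Longrightarrow> c k = m"
    "\<And>k. c k < c (Suc k) \<Longrightarrow> w k + w (g k) + sum w {c k..<c (Suc k) - 1} < 180/239"
    "w s + w (g s) + sum w {c s..<c (Suc s)} < 180/239"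
proof -
  show "s < n" "\<And>k. s < k \<Longrightarrow> c k = m" "c 0 = 2 * n" "c n = m"
    and s: "w s + w (g s) + sum w {c s..<c (Suc s)} < 180/239"
    using assms unfolding stuck_bags_def by auto
  show mono: "\<And>k. c k \<le> c (Suc k)" using assms unfolding stuck_bags_def by auto
  show "2 * n \<le> c k" for k using lift_Suc_mono_le[of c 0 k, OF mono] \<open>c 0 = 2 * n\<close> by simp
  show "w k + w (g k) + sum w {c k..<c (Suc k) - 1} < 180/239" if "c k < c (Suc k)" for k
  proof -
    \<comment> \<open>Bag \<open>s\<close> stays below the threshold even with its last good, and
      the intervals of later bags are empty.\<close>
    consider "k < s" | "k = s" | "s < k" by linarith
    then show ?thesis
    proof cases
      case 1
      then show ?thesis using assms that unfolding stuck_bags_def by blast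
    next
      case 2
      have "sum w {c k..<c (Suc k) - 1} \<le> sum w {c k..<c (Suc k)}"
        by (rule sum_mono2) (auto simp: nonneg)
      then show ?thesis using s 2 by simp
    next
      case 3
      then show ?thesis using assms that unfolding stuck_bags_def by auto
    qed
  qed
qed

text \<open>The weighting argument for tight agents: under \<open>W\<close> every bundle of the
  partition has weight at least 4, while the bags have average weight below 4, the bag at which the
  goods ran out making the inequality strict.\<close>

lemma no_stuck_shifted_pairs:
  assumes x: "59/239 < w (2 * n)" and st: "stuck_bags w n m (\<lambda>k. n + k) c s"
  shows False
proof -
  note st = stuck_bagsD[OF st]
  define p where "p k = w k + w (n + k)" for k
  \<comment> \<open>Critical pairs. A pair below 29/40 is light enough that weights nearly
    proportional to value leave room for one more good.\<close>
  define I where "I k \<longleftrightarrow> 29/40 \<le> p k \<and> p k < 180/239" for k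
  have p_anti: "p l \<le> p k" if "k \<le> l" for k l
    using anti[OF that] anti[of "n + k" "n + l"] that by (simp add: p_def)
  have w0: "w 0 < 121/239" using x r4 by simp
  \<comment> \<open>Both goods of a shifted pair lose value as \<open>k\<close> grows, so the first
    critical pair bounds all of them.\<close>
  obtain U L where UL: "U + L \<le> 180/239" "U \<le> 121/239" "L \<le> 90/239"
    and I_UL: "\<And>k. I k \<Longrightarrow> w k \<le> U \<and> w (n + k) \<le> L"
  proof (cases "\<exists>k. I k")
    case True
    define k0 where "k0 = (LEAST k. I k)"
    have "I k0" unfolding k0_def using True by (rule LeastI_ex)
    show ?thesis
    proof (rule that[of "w k0" "w (n + k0)"])
      show "w k0 + w (n + k0) \<le> 180/239" using \<open>I k0\<close> by (simp add: I_def p_def)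
      show "w k0 \<le> 121/239" using w0 anti[of 0 k0] by simp
      show "w (n + k0) \<le> 90/239" using value_n anti[of n "n + k0"] by simp
      show "w k \<le> w k0 \<and> w (n + k) \<le> w (n + k0)" if "I k" for k
        using Least_le[of I k, OF that] by (auto simp: k0_def[symmetric] intro: anti)
    qed
  next
    case False
    \<comment> \<open>Without critical pairs any admissible values of \<open>U\<close> and
      \<open>L\<close> will do.\<close>
    then show ?thesis by (intro that[of "1/2" "1/4"]) auto
  qed
  obtain \<gamma> \<alpha>A \<alpha>B lQ where gam: "1 \<le> \<gamma>" "\<gamma> \<le> 240/239" and sum4: "\<alpha>A + \<alpha>B + \<gamma> = 4"
    and al: "\<gamma> \<le> \<alpha>B" "\<gamma> \<le> \<alpha>A" and lQ: "1057/1000 * (240/239) - \<gamma> \<le> lQ" "57/1000 * (236/239) \<le> lQ"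
    and slots: "\<And>(a::nat) (b::nat) (r::nat). 4 \<le> a * \<alpha>A + b * \<alpha>B + r * \<gamma> \<or>
       a * (1057/250 * U - \<alpha>A) + b * (1057/250 * L - \<alpha>B) + r * lQ \<le> 57/250"
    using slot_parameters[OF UL] by blast
  \<comment> \<open>The linear branch equals 236/239 at \<open>v = 59/239\<close>, the least
    possible value of a top good. As \<open>\<gamma>\<close> is at most 240/239, taking the maximum
    adds at most 4/239.\<close>
  define E where "E v = max \<gamma> (1057/250 * v - 57/1000 * (236/239))" for v :: real
  define W where "W g = (if g < n then if I g then \<alpha>A else E (w g)
      else if g < 2 * n then if I (g - n) then \<alpha>B else E (w g)
      else if g < 3 * n then min \<gamma> (1057/250 * w g) else 1057/250 * w g)" for g
  \<comment> \<open>There are exactly \<open>n\<close> goods in \<open>{2n..<3n}\<close>, hence one per bag on average: charging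
    \<open>12/125\<close> for each of them gives slack to the bags that contain at least two.\<close>
  define V where "V g = W g - (if 2 * n \<le> g \<and> g < 3 * n then 12/125 else 0)" for g
  define ty :: "nat \<Rightarrow> nat" where "ty g = (if g < n then if I g then 0 else 2
      else if g < 2 * n then if I (g - n) then 1 else 2
      else if g < 3 * n \<and> \<gamma> \<le> 1057/250 * w g then 2 else 3)" for g
  have bundleW: "4 \<le> sum W {g. g < m \<and> \<pi> g = j}" if "j < n" for j
  proof (rule bundle_weight[where ty = ty and e = "1057/250" and lA = "1057/250 * U - \<alpha>A"
        and lB = "1057/250 * L - \<alpha>B" and lQ = lQ and \<alpha>A = \<alpha>A and \<alpha>B = \<alpha>B and \<gamma> = \<gamma> and w = w])
    show "sum w {g. g < m \<and> \<pi> g = j} = 1" using unit that .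
    show "\<alpha>A \<le> W g \<and> 1057/250 * w g - (1057/250 * U - \<alpha>A) \<le> W g" if "ty g = 0" for g
      using that I_UL[of g] by (auto simp: ty_def W_def split: if_splits)
    show "\<alpha>B \<le> W g \<and> 1057/250 * w g - (1057/250 * L - \<alpha>B) \<le> W g" if "ty g = 1" for g
      using that I_UL[of "g - n"] by (auto simp: ty_def W_def split: if_splits)
    show "\<gamma> \<le> W g \<and> 1057/250 * w g - lQ \<le> W g" if "ty g = 2" for g
    proof (cases "g < 2 * n")
      case True
      then have "W g = E (w g)" using that by (auto simp: ty_def W_def split: if_splits)
      then show ?thesis using lQ by (auto simp: E_def max_def)
    next
      case False
      then have "W g = \<gamma>" using that by (auto simp: ty_def W_def split: if_splits)
      moreover have "w g \<le> 60/239" using False anti[of "2 * n" g] value_2n by simp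
      ultimately show ?thesis using lQ by simp
    qed
    show "0 \<le> W g \<and> 1057/250 * w g \<le> W g" if "3 \<le> ty g" for g
      using that nonneg[of g] gam by (auto simp: ty_def W_def split: if_splits)
    show "4 \<le> real a * \<alpha>A + real b * \<alpha>B + real r * \<gamma> \<or>
       real a * (1057/250 * U - \<alpha>A) + real b * (1057/250 * L - \<alpha>B) + real r * lQ \<le> 1057/250 - 4"
      for a b r :: nat
      using slots[of a b r] by simp
  qed simp
  have lowW: "4 * real n \<le> sum W {..<m}"
  proof -
    have "(\<Sum>j<n. 4) \<le> (\<Sum>j<n. sum W {g. g < m \<and> \<pi> g = j})"
      by (rule sum_mono) (use bundleW in auto)
    then show ?thesis using sum_bundles[of m \<pi> n W] label by simp
  qed
  have sumV: "sum V {..<m} = sum W {..<m} - 12/125 * real n"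
  proof -
    have "{g \<in> {..<m}. 2 * n \<le> g \<and> g < 3 * n} = {2 * n..<3 * n}" using m_large by auto
    then show ?thesis unfolding V_def sum_subtractf sum_if_const[OF finite_lessThan] by simp
  qed
  have V_le: "V g \<le> 1057/250 * w g - (if g < 3 * n then 12/125 else 0)" if "2 * n \<le> g" for g
    using that by (auto simp: V_def W_def)
  have V_le': "V g \<le> \<gamma> - 12/125" if "2 * n \<le> g" "g < 3 * n" for g
    using that by (auto simp: V_def W_def)
  have fill: "sum V {a..<b} \<le> 1057/250 * sum w {a..<b}" if "2 * n \<le> a" for a b
    unfolding sum_distrib_left
  proof (rule sum_mono)
    fix g assume "g \<in> {a..<b}"
    then show "V g \<le> 1057/250 * w g" using V_le[of g] that by (auto split: if_splits)
  qed
  have fillC: "sum V {a..<b} \<le> 1057/250 * sum w {a..<b} - 12/125 * real (b - a)"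
    if "2 * n \<le> a" "b \<le> 3 * n" for a b
  proof -
    have "sum V {a..<b} \<le> (\<Sum>g\<in>{a..<b}. 1057/250 * w g - 12/125)"
    proof (rule sum_mono)
      fix g assume "g \<in> {a..<b}"
      then show "V g \<le> 1057/250 * w g - 12/125" using V_le[of g] that by auto
    qed
    then show ?thesis by (simp add: sum_subtractf sum_distrib_left)
  qed
  have small: "w g \<le> 45/239" if "3 * n \<le> g" for g using value_3n anti[OF that] by simp
  have top: "59/239 \<le> w g" if "g < 2 * n" for g using x anti[of g "2 * n"] that by simp
  \<comment> \<open>Here 488/125 is 4 minus the average charge 12/125. The strict version serves bag
    \<open>s\<close>.\<close>
  have bag: "V k + V (n + k) + sum V {a..<b} \<le> 488/125 \<and>
      (p k + sum w {a..<b} < 180/239 \<longrightarrow> V k + V (n + k) + sum V {a..<b} < 488/125)"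
    if k: "k < n" and ab: "2 * n \<le> a" "a \<le> b" and f: "a < b \<Longrightarrow> p k + sum w {a..<b - 1} < 180/239" for k a b
  proof (cases "I k")
    case True
    \<comment> \<open>This leaves \<open>\<gamma> - 12/125\<close> of the allowance, exactly the
      bound \<open>V_le'\<close> on one good from \<open>{2n..<3n}\<close>.\<close>
    have T: "V k + V (n + k) = 4 - \<gamma>" using k True sum4 by (simp add: V_def W_def)
    have pk: "29/40 \<le> p k" using True by (simp add: I_def)
    consider "b = a" | "b = Suc a" | "Suc a < b" using ab by linarith
    then have "V k + V (n + k) + sum V {a..<b} \<le> 488/125"
    proof cases
      case 1
      then show ?thesis using T gam by simp
    next
      case 2
      then show ?thesis using T gam V_le'[of a] V_le[of a] small[of a] ab
        by (cases "a < 3 * n") auto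
    next
      case 3
      \<comment> \<open>The last good is worth at most the first, so the filling is worth at most
        twice the gap between a critical pair and the threshold.\<close>
      have s: "sum w {a..<b} = sum w {a..<b - 1} + w (b - 1)" using 3 by (intro sum_split_last) simp
      have "w (b - 1) \<le> w a" using 3 by (intro anti) simp
      also have "w a \<le> sum w {a..<b - 1}" using 3 by (intro member_le_sum) (auto simp: nonneg)
      finally have "sum w {a..<b} \<le> 2 * (180/239 - 29/40)" using s f 3 pk by simp
      then show ?thesis using fill[of a b] ab T gam by simp
    qed
    moreover have "V k + V (n + k) + sum V {a..<b} < 488/125" if "p k + sum w {a..<b} < 180/239"
    proof -
      have "sum w {a..<b} \<le> 180/239 - 29/40" using that pk by simp
      then show ?thesis using fill[of a b] ab T gam by simp
    qed
    ultimately show ?thesis by blast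
  next
    case False
    have T: "V k + V (n + k) = E (w k) + E (w (n + k))" using k False by (simp add: V_def W_def)
    have t: "59/239 \<le> w k" "59/239 \<le> w (n + k)" using top k by auto
    have pp: "p k = w k + w (n + k)" by (simp add: p_def)
    \<comment> \<open>Unless both goods take the constant branch, at most one of them exceeds the
      linear branch, by at most 4/239.\<close>
    have E2: "E (w k) + E (w (n + k)) = 2 * \<gamma> \<or>
        E (w k) + E (w (n + k)) \<le> 1057/250 * p k - 57/500 * (236/239) + 4/239"
    proof -
      have E_cases: "E v = \<gamma> \<or> E v = 1057/250 * v - 57/1000 * (236/239)" for v
        by (simp add: E_def max_def)
      have E_up: "E v \<le> 1057/250 * v - 57/1000 * (236/239) + 4/239" if "59/239 \<le> v" for v
        using that gam E_cases[of v] by argo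
      show ?thesis using E_cases[of "w k"] E_cases[of "w (n + k)"] E_up[OF t(1)] E_up[OF t(2)]
        unfolding pp by argo
    qed
    have p2: "118/239 \<le> p k" using t pp by simp
    have p_max: "p k \<le> 211/239"
      using w0 value_n anti[of 0 k] anti[of n "n + k"] pp by simp
    consider "b = a" | "b = Suc a" "b \<le> 3 * n" | "Suc (Suc a) = b" "b \<le> 3 * n" | "Suc (Suc a) < b" "b \<le> 3 * n"
      | "a < b" "3 * n < b" using ab by linarith
    then have "V k + V (n + k) + sum V {a..<b} \<le> 488/125"
    proof cases
      case 1
      then show ?thesis using T E2 gam p_max by auto
    next
      case 2
      have "p k < 29/40" using f 2 False by (auto simp: I_def)
      then show ?thesis using T E2 gam V_le'[of a] 2 ab by auto
    next
      case 3
      then have s: "sum V {a..<b} = V a + V (Suc a)" by (auto simp: sum.atLeastLessThan_Suc)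
      have "V a \<le> 1057/250 * w a - 12/125" "V a \<le> \<gamma> - 12/125" "V (Suc a) \<le> \<gamma> - 12/125"
        using V_le[of a] V_le'[of a] V_le'[of "Suc a"] ab 3 by auto
      moreover have "p k + w a < 180/239" using f 3 by auto
      ultimately show ?thesis using T E2 gam s by auto
    next
      case 4
      have s: "sum V {a..<b} = sum V {a..<b - 1} + V (b - 1)" using 4 by (intro sum_split_last) simp
      have "2 \<le> real (b - 1 - a)" using 4 by simp
      moreover have "sum V {a..<b - 1} \<le> 1057/250 * sum w {a..<b - 1} - 12/125 * real (b - 1 - a)"
        using fillC[of a "b - 1"] ab 4 by simp
      ultimately have "sum V {a..<b - 1} \<le> 1057/250 * sum w {a..<b - 1} - 24/125" by linarith
      moreover have "V (b - 1) \<le> \<gamma> - 12/125" using V_le'[of "b - 1"] ab 4 by auto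
      moreover have "p k + sum w {a..<b - 1} < 180/239" using f 4 by auto
      ultimately show ?thesis using T E2 gam s p2 by auto
    next
      case 5
      have s: "sum V {a..<b} = sum V {a..<b - 1} + V (b - 1)" using 5 by (intro sum_split_last) simp
      have "sum V {a..<b - 1} \<le> 1057/250 * sum w {a..<b - 1}" using fill ab by blast
      moreover have "3 * n \<le> b - 1" using 5 by simp
      then have "V (b - 1) \<le> 1057/250 * (45/239)" using V_le[of "b - 1"] small[of "b - 1"] by simp
      moreover have "p k + sum w {a..<b - 1} < 180/239" using f 5 by auto
      ultimately show ?thesis using T E2 gam s p2 by auto
    qed
    moreover have "V k + V (n + k) + sum V {a..<b} < 488/125" if "p k + sum w {a..<b} < 180/239"
      using that fill[of a b] ab T E2 gam p2 by auto
    ultimately show ?thesis by blast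
  qed
  have "sum V {..<m} = (\<Sum>k<n. V k + V (n + k) + sum V {c k..<c (Suc k)})"
    by (rule sum_bags[OF st(2) st(3) st(4) bij_shift])
  also have "\<dots> < (\<Sum>k<n. 488/125)"
  proof (rule sum_strict_mono_ex1)
    show "\<forall>k\<in>{..<n}. V k + V (n + k) + sum V {c k..<c (Suc k)} \<le> 488/125"
      using bag st(2,5,7) by (auto simp: p_def)
    have "V s + V (n + s) + sum V {c s..<c (Suc s)} < 488/125"
      using bag[OF st(1) st(5) st(2), of s] st(7)[of s] st(8) unfolding p_def by blast
    then show "\<exists>k\<in>{..<n}. V k + V (n + k) + sum V {c k..<c (Suc k)} < 488/125"
      using st(1) by blast
  qed simp
  finally show False using lowW sumV by simp
qed

lemma bag_value_upper:
  assumes "stuck_bags w n m g c s" and "c k < c (Suc k)"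
  shows "w k + w (g k) + sum w {c k..<c (Suc k)} < 180/239 + w (2 * n)"
proof -
  note st = stuck_bagsD[OF assms(1)]
  have "2 * n \<le> c (Suc k) - 1" using st(5)[of k] assms(2) by simp
  from anti[OF this] show ?thesis
    using st(7)[OF assms(2)] sum_split_last[OF assms(2), of w] by simp
qed

text \<open>A filled bag is worth less than 180/239 + 59/239 = 1, so only pairs worth more than 1
  are a threat. If there are any, their larger goods fill bundles almost alone, and a reweighting
  caps every bag at 1 without taking any bundle below 1.\<close>

lemma no_stuck_mirrored_pairs:
  assumes x: "w (2 * n) \<le> 59/239" and stuck: "stuck_bags w n m (\<lambda>k. 2 * n - 1 - k) c s"
  shows False
proof -
  note st = stuck_bagsD[OF stuck]
  note up = bag_value_upper[OF stuck]
  define p where "p k = w k + w (2 * n - 1 - k)" for k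
  note bags = sum_bags[OF st(2) st(3) st(4) bij_mirror]
  show False
  proof (cases "\<forall>k<n. p k \<le> 1")
    case True
    have "sum w {..<m} = (\<Sum>k<n. w k + w (2 * n - 1 - k) + sum w {c k..<c (Suc k)})"
      by (rule bags)
    also have "\<dots> < (\<Sum>k<n. 1)"
    proof (rule sum_strict_mono_ex1)
      show "\<forall>k\<in>{..<n}. w k + w (2 * n - 1 - k) + sum w {c k..<c (Suc k)} \<le> 1"
      proof
        fix k assume "k \<in> {..<n}"
        then show "w k + w (2 * n - 1 - k) + sum w {c k..<c (Suc k)} \<le> 1"
          using up[of k] x True st(2)[of k] by (cases "c k < c (Suc k)") (auto simp: p_def)
      qed
      have "w s + w (2 * n - 1 - s) + sum w {c s..<c (Suc s)} < 1" using st(8) by simp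
      then show "\<exists>k\<in>{..<n}. w k + w (2 * n - 1 - k) + sum w {c k..<c (Suc k)} < 1"
        using st(1) by blast
    qed simp
    finally show False using total by simp
  next
    case False
    define L where "L = Max {k. k < n \<and> 1 < p k}"
    have fin: "finite {k. k < n \<and> 1 < p k}" and ne: "{k. k < n \<and> 1 < p k} \<noteq> {}"
      using False by (auto simp: not_le)
    have L: "L < n" "1 < p L" using Max_in[OF fin ne] by (auto simp: L_def)
    have p1: "p k \<le> 1" if "L < k" "k < n" for k
      using Max_ge[OF fin, of k] that by (force simp: L_def[symmetric])
    define y where "y = w (2 * n - 1 - L)"
    define q where "q = 3/2 * (59/239 + w (2 * n))"
    have wL: "1 - y < w L" using L by (simp add: p_def y_def)
    have big: "1 - y < w g" if "g \<le> L" for g using wL anti[OF that] by simp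
    have ny: "y \<le> w g" if "g \<le> 2 * n - 1 - L" for g using anti[OF that] by (simp add: y_def)
    \<comment> \<open>Values above \<open>1 - y\<close> and at least \<open>y\<close> do not fit
      together into a bundle of value 1.\<close>
    have alone: "g' \<noteq> g \<Longrightarrow> \<pi> g' \<noteq> \<pi> g" if "g \<le> L" "g' \<le> 2 * n - 1 - L" for g g'
    proof
      assume "g' \<noteq> g" and eq: "\<pi> g' = \<pi> g"
      have gm: "g < m" "g' < m" using that L(1) m_large by auto
      have "w g + w g' = sum w {g, g'}" using \<open>g' \<noteq> g\<close> by simp
      also have "\<dots> \<le> sum w {h. h < m \<and> \<pi> h = \<pi> g}"
        by (rule sum_mono2) (use gm eq nonneg in auto)
      also have "\<dots> = 1" using unit[OF label[OF gm(1)]] .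
      finally show False using big[OF that(1)] ny[OF that(2)] by simp
    qed
    \<comment> \<open>By \<open>alone\<close>, the \<open>2 * (n - Suc L) + 1\<close> goods of
      \<open>?X\<close> lie in the \<open>n - Suc L\<close> bundles of \<open>?Y\<close>. Some
      bundle holds three of them, each worth at least \<open>y\<close>.\<close>
    have "y \<le> 1/3"
    proof -
      let ?X = "{Suc L..2 * n - 1 - L}" and ?Y = "{..<n} - \<pi> ` {..L}"
      have inj: "inj_on \<pi> {..L}"
      proof (rule inj_onI, rule ccontr)
        fix g g' assume "g \<in> {..L}" "g' \<in> {..L}" "\<pi> g = \<pi> g'" "g \<noteq> g'"
        then show False using alone[of g' g] L(1) by simp
      qed
      have "card (\<pi> ` {..L}) = Suc L" using card_image[OF inj] by simp
      moreover have sub: "\<pi> ` {..L} \<subseteq> {..<n}" using label L(1) m_large by auto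
      ultimately have cY: "card ?Y = n - Suc L"
        by (simp add: card_Diff_subset finite_subset)
      have map: "\<pi> ` ?X \<subseteq> ?Y"
      proof
        fix j assume "j \<in> \<pi> ` ?X"
        then obtain g where g: "g \<in> ?X" "j = \<pi> g" by blast
        have "\<pi> g < n" using g L(1) m_large by (intro label) auto
        moreover have "\<pi> g \<notin> \<pi> ` {..L}"
        proof
          assume "\<pi> g \<in> \<pi> ` {..L}"
          then obtain g' where "g' \<le> L" "\<pi> g = \<pi> g'" by auto
          then show False using alone[of g' g] g by auto
        qed
        ultimately show "j \<in> ?Y" using g by simp
      qed
      have "\<exists>j\<in>?Y. 3 \<le> card {g \<in> ?X. \<pi> g = j}"
      proof (rule ccontr)
        assume no: "\<not> ?thesis"
        have "card ?X = (\<Sum>j\<in>?Y. card {g \<in> ?X. \<pi> g = j})"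
          using sum.group[of ?X ?Y \<pi> "\<lambda>_. 1 :: nat"] map by simp
        also have "\<dots> \<le> (\<Sum>j\<in>?Y. 2)" by (rule sum_mono) (use no in force)
        finally show False using cY L(1) by simp
      qed
      then obtain j where j: "j < n" "3 \<le> card {g \<in> ?X. \<pi> g = j}" by auto
      have "3 * y \<le> real (card {g \<in> ?X. \<pi> g = j}) * y"
      proof (rule mult_right_mono)
        show "0 \<le> y" unfolding y_def by (rule nonneg)
      qed (use j in simp)
      also have "\<dots> = (\<Sum>g\<in>{g \<in> ?X. \<pi> g = j}. y)" by simp
      also have "\<dots> \<le> sum w {g \<in> ?X. \<pi> g = j}" by (rule sum_mono) (use ny in auto)
      also have "\<dots> \<le> sum w {g. g < m \<and> \<pi> g = j}"
        by (rule sum_mono2) (use nonneg m_large L(1) in auto)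
      finally show ?thesis using unit[OF j(1)] by simp
    qed
    then have two3: "2/3 < w g" if "g \<le> L" for g using big[OF that] by simp
    have x_up: "w (2 * n) < 180/239 - 2/3" using two3[of 0] r4 by simp
    have y_low: "59/239 + w (2 * n) \<le> y" using big[of 0] r4 by simp
    have w0: "w g \<le> 180/239 - w (2 * n)" for g using r4 anti[of 0 g] by simp
    have q3: "1/3 \<le> q" "q = 3/2 * (59/239 + w (2 * n))" using nonneg[of "2 * n"] by (auto simp: q_def)
    \<comment> \<open>A bundle has at most one good \<open>g \<le> L\<close>, and the rest of such a bundle is worth at least
      \<open>2/3 * q\<close>, so its weight is at least \<open>q\<close>.\<close>
    define W where "W g = (if g \<le> L then 1 - q else if g < 2 * n - 1 - L then w g else min q (3/2 * w g))" for g
    have W_light: "w g \<le> W g" "0 \<le> W g" if "L < g" for g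
    proof -
      have "w g \<le> y" if "\<not> g < 2 * n - 1 - L" using that by (auto simp: y_def intro: anti)
      then show "w g \<le> W g" using that \<open>y \<le> 1/3\<close> q3 nonneg[of g] by (auto simp: W_def)
      then show "0 \<le> W g" using nonneg[of g] by simp
    qed
    have bundleW: "1 \<le> sum W {g. g < m \<and> \<pi> g = j}" if "j < n" for j
    proof (cases "\<exists>b\<le>L. \<pi> b = j")
      case True
      then obtain b where b: "b \<le> L" "\<pi> b = j" by blast
      let ?R = "{g. g < m \<and> \<pi> g = j} - {b}"
      have bm: "b < m" using b L(1) m_large by simp
      have far: "2 * n - 1 - L < g" if "g \<in> ?R" for g using alone[of b g] b that by force
      have farL: "L < g" if "g \<in> ?R" for g using far[OF that] L(1) by simp
      have Rw: "sum w ?R = 1 - w b"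
        using unit[OF \<open>j < n\<close>] bm b sum.remove[of "{g. g < m \<and> \<pi> g = j}" b w] by simp
      have "q \<le> sum W ?R"
      proof (cases "\<exists>g\<in>?R. q \<le> 3/2 * w g")
        case True
        then obtain g where g: "g \<in> ?R" "q \<le> 3/2 * w g" by blast
        have "W g = q" using far[OF g(1)] farL[OF g(1)] g(2) by (simp add: W_def)
        moreover have "W g \<le> sum W ?R" by (rule member_le_sum) (use g farL W_light in auto)
        ultimately show ?thesis by simp
      next
        case False
        have "sum W ?R = sum (\<lambda>g. 3/2 * w g) ?R"
        proof (rule sum.cong)
          fix g assume g: "g \<in> ?R"
          have "3/2 * w g < q" using False g by force
          then show "W g = 3/2 * w g" using far[OF g] farL[OF g] by (simp add: W_def)
        qed simp
        also have "\<dots> = 3/2 * (1 - w b)" unfolding Rw[symmetric] by (rule sum_distrib_left[symmetric])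
        finally show ?thesis using w0[of b] q3 by simp
      qed
      moreover have "sum W {g. g < m \<and> \<pi> g = j} = W b + sum W ?R"
        using bm b by (intro sum.remove) auto
      moreover have "W b = 1 - q" using b by (simp add: W_def)
      ultimately show ?thesis by simp
    next
      case False
      have "sum w {g. g < m \<and> \<pi> g = j} \<le> sum W {g. g < m \<and> \<pi> g = j}"
        by (rule sum_mono) (use False W_light not_le in blast)
      then show ?thesis using unit[OF that] by simp
    qed
    have low: "real n \<le> sum W {..<m}"
    proof -
      have "(\<Sum>j<n. 1) \<le> (\<Sum>j<n. sum W {g. g < m \<and> \<pi> g = j})"
        by (rule sum_mono) (use bundleW in auto)
      then show ?thesis using sum_bundles[of m \<pi> n W] label by simp
    qed
    have fill: "sum W {a..<b} \<le> 3/2 * sum w {a..<b}" if "2 * n \<le> a" for a b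
      unfolding sum_distrib_left by (rule sum_mono) (use that L(1) in \<open>auto simp: W_def\<close>)
    \<comment> \<open>In a pair up to \<open>L\<close> the larger good, worth more than 2/3, weighs
      only \<open>1 - q\<close>. A later pair is worth at least \<open>2 * y\<close> and weighs
      exactly its value, so the factor 3/2 affects only the filling.\<close>
    have cheap: "W k + W (2 * n - 1 - k) + sum W {a..<b} < 1"
      if k: "k < n" and a: "2 * n \<le> a"
        and v: "p k + sum w {a..<b} < 180/239 + w (2 * n)" for k a b
    proof (cases "k \<le> L")
      case True
      have "W k + W (2 * n - 1 - k) \<le> 1 - q + 3/2 * w (2 * n - 1 - k)"
        using True k L(1) by (auto simp: W_def)
      then show ?thesis using fill[OF a, of b] v[unfolded p_def] two3[OF True] q3(2) by argo
    next
      case False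
      have "W k + W (2 * n - 1 - k) = p k"
        using False k by (auto simp: W_def p_def)
      moreover have "y \<le> w k" "y \<le> w (2 * n - 1 - k)" using False k L(1) by (auto intro!: ny)
      then have "2 * y \<le> p k" by (simp add: p_def)
      ultimately show ?thesis using fill[OF a, of b] v x_up y_low by simp
    qed
    have bag: "W k + W (2 * n - 1 - k) + sum W {c k..<c (Suc k)} \<le> 1" if k: "k < n" for k
    proof (cases "c k < c (Suc k)")
      case True
      then show ?thesis using cheap[OF k st(5)[of k]] up[OF True] by (simp add: p_def less_imp_le)
    next
      case False
      \<comment> \<open>However valuable, a pair up to \<open>L\<close> weighs at most
        \<open>(1 - q) + q\<close>.\<close>
      have "W k + W (2 * n - 1 - k) \<le> 1"
        using p1[of k] k L(1) by (cases "k \<le> L") (auto simp: W_def p_def)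
      then show ?thesis using False by simp
    qed
    have "sum W {..<m} = (\<Sum>k<n. W k + W (2 * n - 1 - k) + sum W {c k..<c (Suc k)})"
      by (rule bags)
    also have "\<dots> < (\<Sum>k<n. 1)"
    proof (rule sum_strict_mono_ex1)
      show "\<forall>k\<in>{..<n}. W k + W (2 * n - 1 - k) + sum W {c k..<c (Suc k)} \<le> 1"
        using bag by blast
      have "p s + sum w {c s..<c (Suc s)} < 180/239 + w (2 * n)"
        using st(8) nonneg[of "2 * n"] by (simp add: p_def)
      then show "\<exists>k\<in>{..<n}. W k + W (2 * n - 1 - k) + sum W {c k..<c (Suc k)} < 1"
        using cheap[OF st(1) st(5)] st(1) by blast
    qed simp
    finally show False using low by simp
  qed
qed

text \<open>Bags in \<open>S\<close> are worth at most 240/239 and all others at most 211/239. With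
  at most three quarters of the bags in \<open>S\<close> the average is below 1.\<close>

lemma no_stuck_mirrored_pairs_priority:
  assumes x: "59/239 < w (2 * n)" and stuck: "stuck_bags w n m (\<lambda>k. 2 * n - 1 - k) c s"
    and S: "S \<subseteq> {..<s}" "4 * card S \<le> 3 * n"
    and low: "\<And>k. k < s \<Longrightarrow> k \<notin> S \<Longrightarrow> w k + w (2 * n - 1 - k) + sum w {c k..<c (Suc k)} < 180/239"
  shows False
proof -
  note st = stuck_bagsD[OF stuck]
  have p: "w k + w (2 * n - 1 - k) < 211/239" if "k < n" for k
  proof -
    have "w (2 * n - 1 - k) \<le> w n" using that by (intro anti) simp
    then show ?thesis using x r4 value_n anti[of 0 k] by simp
  qed
  have "sum w {..<m} = (\<Sum>k<n. w k + w (2 * n - 1 - k) + sum w {c k..<c (Suc k)})"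
    by (rule sum_bags[OF st(2) st(3) st(4) bij_mirror])
  also have "\<dots> \<le> card S * (240/239) + (real n - card S) * (211/239)"
  proof (rule sum_two_level)
    show "S \<subseteq> {..<n}" using S st(1) by auto
    fix k assume k: "k < n"
    show "w k + w (2 * n - 1 - k) + sum w {c k..<c (Suc k)} \<le> (if k \<in> S then 240/239 else 211/239)"
    proof (cases "k < s")
      case True
      then show ?thesis using low[of k] bag_value_upper[OF stuck, of k] p[OF k] value_2n st(2)[of k]
        by (cases "c k < c (Suc k)") force+
    next
      case False
      then show ?thesis using S p[OF k] st(6,8) by (cases "k = s") force+
    qed
  qed
  also have "\<dots> < n"
  proof -
    have "4 * real (card S) \<le> 3 * real n" using S(2) by (metis of_nat_le_iff of_nat_mult of_nat_numeral)
    moreover have "1 \<le> real n" using n_pos by simp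
    ultimately show ?thesis by argo
  qed
  finally show False using total by simp
qed

text \<open>Bags in \<open>S\<close> are worth at most 270/239 and all others at most 180/239. With
  less than a quarter of the bags in \<open>S\<close> the average is below 1.\<close>

lemma no_stuck_shifted_pairs_priority:
  assumes stuck: "stuck_bags w n m (\<lambda>k. n + k) c s"
    and S: "S \<subseteq> {..<s}" "4 * card S < n"
    and low: "\<And>k. k < s \<Longrightarrow> k \<notin> S \<Longrightarrow> w k + w (n + k) + sum w {c k..<c (Suc k)} < 180/239"
  shows False
proof -
  note st = stuck_bagsD[OF stuck]
  have p: "w k + w (n + k) < 270/239" if "k < n" for k
    using r4 nonneg[of "2 * n"] value_n anti[of 0 k] anti[of n "n + k"] that by simp
  have "sum w {..<m} = (\<Sum>k<n. w k + w (n + k) + sum w {c k..<c (Suc k)})"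
    by (rule sum_bags[OF st(2) st(3) st(4) bij_shift])
  also have "\<dots> \<le> card S * (270/239) + (real n - card S) * (180/239)"
  proof (rule sum_two_level)
    show "S \<subseteq> {..<n}" using S st(1) by auto
    fix k assume k: "k < n"
    show "w k + w (n + k) + sum w {c k..<c (Suc k)} \<le> (if k \<in> S then 270/239 else 180/239)"
    proof (cases "k < s")
      case True
      then show ?thesis using low[of k] bag_value_upper[OF stuck, of k] p[OF k] value_2n st(2)[of k]
        by (cases "c k < c (Suc k)") force+
    next
      case False
      \<comment> \<open>An unfilled pair after \<open>s\<close> is worth no more than pair
        \<open>s\<close>, which stayed below the threshold.\<close>
      have "0 \<le> sum w {c s..<c (Suc s)}" by (intro sum_nonneg nonneg)
      moreover have "w k \<le> w s" "w (n + k) \<le> w (n + s)" using False by (auto intro: anti)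
      ultimately show ?thesis using S False st(6)[of k] st(6)[of "Suc k"] st(8) by (cases "k = s") force+
    qed
  qed
  also have "\<dots> < n"
  proof -
    have "4 * real (card S) < real n" using S(2) by (metis of_nat_less_iff of_nat_mult of_nat_numeral)
    moreover have "1 \<le> real n" using n_pos by simp
    ultimately show ?thesis by argo
  qed
  finally show False using total by simp
qed

end

section \<open>Irreducible instances\<close>

lemma allocation_from_bags:
  fixes w :: "nat \<Rightarrow> nat \<Rightarrow> real" and b :: real
  assumes inj: "inj_on \<sigma> {..<n}" and ran: "\<sigma> ` {..<n} \<subseteq> {..<n}"
    and mono: "\<And>k. c k \<le> c (Suc k)" and c0: "c 0 = 2 * n" and cn: "c n \<le> m"
    and g: "bij_betw g {..<n} {n..<2 * n}"
    and sat: "\<And>k. k < n \<Longrightarrow> b \<le> w (\<sigma> k) k + w (\<sigma> k) (g k) + sum (w (\<sigma> k)) {c k..<c (Suc k)}"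
  shows "\<exists>A. (\<forall>i<n. A i \<subseteq> {..<m}) \<and> (\<forall>i<n. \<forall>j<n. i \<noteq> j \<longrightarrow> A i \<inter> A j = {}) \<and>
             (\<forall>i<n. b \<le> sum (w i) (A i))"
proof -
  define D where "D k = {k, g k} \<union> {c k..<c (Suc k)}" for k
  have bij: "bij_betw \<sigma> {..<n} {..<n}"
    using inj ran by (simp add: bij_betw_def endo_inj_surj)
  have c_le: "c k \<le> c l" if "k \<le> l" for k l using lift_Suc_mono_le[of c k l] mono that by simp
  have gk: "n \<le> g k" "g k < 2 * n" if "k < n" for k using g that by (auto dest: bij_betwE)
  have c2: "2 * n \<le> c k" for k using c_le[of 0 k] c0 by simp
  have disj: "D k \<inter> D l = {}" if "k < l" "l < n" for k l
  proof -
    have "g k \<noteq> g l" using g that by (auto simp: bij_betw_def inj_on_def)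
    moreover have "c (Suc k) \<le> c l" using that by (intro c_le) simp
    ultimately show ?thesis using gk[of k] gk[of l] c2[of k] c2[of l] that by (auto simp: D_def)
  qed
  define \<tau> where "\<tau> = inv_into {..<n} \<sigma>"
  have tau: "\<tau> i < n" "\<sigma> (\<tau> i) = i" if "i < n" for i
    using bij_betw_inv_into_right[OF bij, of i] bij_betwE[OF bij_betw_inv_into[OF bij]] that
    by (auto simp: \<tau>_def)
  show ?thesis
  proof (intro exI conjI allI impI)
    show "D (\<tau> i) \<subseteq> {..<m}" if "i < n" for i
    proof -
      have "c (Suc (\<tau> i)) \<le> m" using c_le[of "Suc (\<tau> i)" n] tau(1)[OF that] cn by simp
      moreover have "2 * n \<le> m" using c2[of n] cn by simp
      ultimately show ?thesis using gk[OF tau(1)[OF that]] tau(1)[OF that] by (auto simp: D_def)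
    qed
    show "D (\<tau> i) \<inter> D (\<tau> j) = {}" if "i < n" "j < n" "i \<noteq> j" for i j
    proof -
      have "\<tau> i \<noteq> \<tau> j" using tau that by metis
      then consider "\<tau> i < \<tau> j" | "\<tau> j < \<tau> i" by linarith
      then show ?thesis using disj tau(1) that by cases blast+
    qed
    show "b \<le> sum (w i) (D (\<tau> i))" if "i < n" for i
    proof -
      let ?k = "\<tau> i"
      have k: "?k < n" using tau that by simp
      have "sum (w i) (D ?k) = sum (w i) {?k, g ?k} + sum (w i) {c ?k..<c (Suc ?k)}"
        unfolding D_def by (rule sum.union_disjoint) (use gk[OF k] k c2[of ?k] in auto)
      also have "sum (w i) {?k, g ?k} = w i ?k + w i (g ?k)" using gk[OF k] k by simp
      finally show ?thesis using sat[OF k] tau(2)[OF that] by simp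
    qed
  qed
qed

text \<open>The preferred agents are \<open>H\<close> for mirrored pairs and its complement for
  shifted pairs. By \<open>cardS\<close> their number bounds the bags that an unserved preferred
  agent may value at the threshold or more.\<close>

lemma irreducible_allocation:
  fixes w :: "nat \<Rightarrow> nat \<Rightarrow> real"
  assumes n: "1 \<le> n" and agent: "\<And>i. i < n \<Longrightarrow> ordered_agent n m (w i) (\<pi> i)"
  shows "\<exists>A. (\<forall>i<n. A i \<subseteq> {..<m}) \<and> (\<forall>i<n. \<forall>j<n. i \<noteq> j \<longrightarrow> A i \<inter> A j = {}) \<and>
             (\<forall>i<n. 180/239 \<le> sum (w i) (A i))"
proof -
  have m: "2 * n \<le> m" using ordered_agent.m_large[OF agent[of 0]] n by simp
  \<comment> \<open>\<open>H\<close> is the set of tight agents.\<close>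
  define H where "H = {i. i < n \<and> 59/239 < w i (2 * n)}"
  have fH: "finite H" "H \<subseteq> {..<n}" by (auto simp: H_def)
  have cardS: "card {k. k < s \<and> \<sigma> k \<in> Q} \<le> card Q" if "inj_on \<sigma> {..<s}" "finite Q" for s Q and \<sigma> :: "nat \<Rightarrow> nat"
  proof (rule card_inj_on_le)
    show "inj_on \<sigma> {k. k < s \<and> \<sigma> k \<in> Q}" using that(1) by (auto simp: inj_on_def)
  qed (use that in auto)
  show ?thesis
  proof (cases "4 * card H \<le> 3 * n")
    case True
    let ?g = "\<lambda>k. 2 * n - 1 - k"
    have g: "bij_betw ?g {..<n} {n..<2 * n}" by (rule bij_mirror)
    from bag_filling[OF m, of n "180/239" "\<lambda>i k. w i k + w i (?g k)" w H]
    show ?thesis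
    proof (elim disjE exE conjE)
      fix \<sigma> c
      assume "inj_on \<sigma> {..<n}" "\<sigma> ` {..<n} \<subseteq> {..<n}" "\<forall>k. c k \<le> c (Suc k)" "c 0 = 2 * n" "c n \<le> m"
        "\<forall>k<n. 180/239 \<le> w (\<sigma> k) k + w (\<sigma> k) (?g k) + sum (w (\<sigma> k)) {c k..<c (Suc k)}"
      then show ?thesis using allocation_from_bags[of \<sigma> n c m ?g "180/239" w] g by blast
    next
      fix \<sigma> c s i
      assume a: "s < n" "i < n" "inj_on \<sigma> {..<s}" "\<sigma> ` {..<s} \<subseteq> {..<n}" "i \<notin> \<sigma> ` {..<s}"
        "\<forall>k. c k \<le> c (Suc k)" "c 0 = 2 * n" "\<forall>k>s. c k = m"
        "\<forall>k<s. c k < c (Suc k) \<longrightarrow> w i k + w i (?g k) + sum (w i) {c k..<c (Suc k) - 1} < 180/239"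
        "w i s + w i (?g s) + sum (w i) {c s..<c (Suc s)} < 180/239"
        "i \<in> H \<longrightarrow> (\<forall>k<s. \<sigma> k \<notin> H \<longrightarrow> w i k + w i (?g k) + sum (w i) {c k..<c (Suc k)} < 180/239)"
      then have st: "stuck_bags (w i) n m ?g c s" by (simp add: stuck_bags_def)
      interpret ordered_agent n m "w i" "\<pi> i" using agent a(2) .
      show ?thesis
      proof (cases "i \<in> H")
        case iH: True
        have "\<And>k. k < s \<Longrightarrow> k \<notin> {k. k < s \<and> \<sigma> k \<in> H} \<Longrightarrow>
            w i k + w i (?g k) + sum (w i) {c k..<c (Suc k)} < 180/239"
          using a(11) iH by blast
        then show ?thesis
          using no_stuck_mirrored_pairs_priority[OF _ st, of "{k. k < s \<and> \<sigma> k \<in> H}"]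
            cardS[OF a(3) fH(1)] True iH by (force simp: H_def)
      next
        case False
        then show ?thesis using no_stuck_mirrored_pairs[OF _ st] a(2) by (force simp: H_def)
      qed
    qed
  next
    case False
    define Q where "Q = {..<n} - H"
    have fQ: "finite Q" "4 * card Q < n"
      using False fH n card_Diff_subset[of H "{..<n}"] by (auto simp: Q_def)
    let ?g = "\<lambda>k. n + k"
    have g: "bij_betw ?g {..<n} {n..<2 * n}" by (rule bij_shift)
    from bag_filling[OF m, of n "180/239" "\<lambda>i k. w i k + w i (?g k)" w Q]
    show ?thesis
    proof (elim disjE exE conjE)
      fix \<sigma> c
      assume "inj_on \<sigma> {..<n}" "\<sigma> ` {..<n} \<subseteq> {..<n}" "\<forall>k. c k \<le> c (Suc k)" "c 0 = 2 * n" "c n \<le> m"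
        "\<forall>k<n. 180/239 \<le> w (\<sigma> k) k + w (\<sigma> k) (?g k) + sum (w (\<sigma> k)) {c k..<c (Suc k)}"
      then show ?thesis using allocation_from_bags[of \<sigma> n c m ?g "180/239" w] g by blast
    next
      fix \<sigma> c s i
      assume a: "s < n" "i < n" "inj_on \<sigma> {..<s}" "\<sigma> ` {..<s} \<subseteq> {..<n}" "i \<notin> \<sigma> ` {..<s}"
        "\<forall>k. c k \<le> c (Suc k)" "c 0 = 2 * n" "\<forall>k>s. c k = m"
        "\<forall>k<s. c k < c (Suc k) \<longrightarrow> w i k + w i (?g k) + sum (w i) {c k..<c (Suc k) - 1} < 180/239"
        "w i s + w i (?g s) + sum (w i) {c s..<c (Suc s)} < 180/239"
        "i \<in> Q \<longrightarrow> (\<forall>k<s. \<sigma> k \<notin> Q \<longrightarrow> w i k + w i (?g k) + sum (w i) {c k..<c (Suc k)} < 180/239)"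
      then have st: "stuck_bags (w i) n m ?g c s" by (simp add: stuck_bags_def)
      interpret ordered_agent n m "w i" "\<pi> i" using agent a(2) .
      show ?thesis
      proof (cases "i \<in> Q")
        case iQ: True
        have "\<And>k. k < s \<Longrightarrow> k \<notin> {k. k < s \<and> \<sigma> k \<in> Q} \<Longrightarrow>
            w i k + w i (?g k) + sum (w i) {c k..<c (Suc k)} < 180/239"
          using a(11) iQ by blast
        then show ?thesis
          using no_stuck_shifted_pairs_priority[OF st, of "{k. k < s \<and> \<sigma> k \<in> Q}"]
            cardS[OF a(3) fQ(1)] fQ(2) by force
      next
        case False
        then show ?thesis using no_stuck_shifted_pairs[OF _ st] a(2) by (force simp: Q_def H_def)
      qed
    qed
  qed
qed

section \<open>Reductions\<close>

text \<open>Giving away goods \<open>0\<close> and \<open>2n\<close> may cost another agent up to \<open>4\<delta>/3\<close> in one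
  bundle, where \<open>\<delta> = 3/3836\<close>: good \<open>2n\<close>, worth at most \<open>1/4 + \<delta>/3 = 240/959\<close>, is
  replaced by a chunk, the rest of the bundle of good \<open>0\<close>, worth at least \<open>1/4 - \<delta> = 239/959\<close>.
  Counting every chunk with the nominal value \<open>240/959\<close> shows that these losses do not accumulate:
  with at most three chunks a bundle has lost at most \<open>4\<delta>\<close>, and four chunks alone are worth
  \<open>1 - 4\<delta> = 956/959\<close>.\<close>

fun chunked :: "(nat \<Rightarrow> real) \<Rightarrow> nat \<Rightarrow> real \<Rightarrow> nat set \<Rightarrow> bool" where
  "chunked u 0 t B \<longleftrightarrow> t \<le> sum u B"
| "chunked u (Suc c) t B \<longleftrightarrow> (\<exists>C\<subseteq>B. 239/959 \<le> sum u C \<and> chunked u c (t - 240/959) (B - C))"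

lemma chunked_SucI:
  "C \<subseteq> B \<Longrightarrow> 239/959 \<le> sum u C \<Longrightarrow> chunked u c (t - 240/959) (B - C) \<Longrightarrow> chunked u (Suc c) t B"
  unfolding chunked.simps by blast

definition near_unit :: "(nat \<Rightarrow> real) \<Rightarrow> nat set \<Rightarrow> bool" where
  "near_unit u B \<longleftrightarrow> (\<exists>c. chunked u c 1 B)"

lemma sum_image_dominated:
  fixes u u' :: "nat \<Rightarrow> real"
  assumes "finite B'" "\<And>g. 0 \<le> u' g" "inj_on \<phi> B" "\<And>g. g \<in> B \<Longrightarrow> u g \<le> u' (\<phi> g)" "\<phi> ` B \<subseteq> B'"
  shows "sum u B \<le> sum u' B'"
proof -
  have "sum u B \<le> (\<Sum>g\<in>B. u' (\<phi> g))" by (rule sum_mono) (use assms in auto)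
  also have "\<dots> = sum u' (\<phi> ` B)" using assms(3) by (simp add: sum.reindex)
  also have "\<dots> \<le> sum u' B'" by (rule sum_mono2) (use assms in auto)
  finally show ?thesis .
qed

text \<open>Chunks survive any injective exchange of goods for goods worth at least as much. This
  covers block removal, relabelling and enlarging a bundle.\<close>

lemma chunked_image:
  assumes "chunked u c t B" and "finite B'" and nn: "\<And>g. 0 \<le> u' g" and "inj_on \<phi> B"
    and "\<And>g. g \<in> B \<Longrightarrow> u g \<le> u' (\<phi> g)" and "\<phi> ` B \<subseteq> B'"
  shows "chunked u' c t B'"
  using assms(1,2,4-)
proof (induction c arbitrary: t B B')
  case 0
  then show ?case using sum_image_dominated[of B' u' \<phi> B u] nn by force
next
  case (Suc c)
  then obtain C where C: "C \<subseteq> B" "239/959 \<le> sum u C" "chunked u c (t - 240/959) (B - C)" by auto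
  have "sum u C \<le> sum u' (\<phi> ` C)"
  proof (rule sum_image_dominated)
    show "finite (\<phi> ` C)" using Suc.prems(2,5) C(1) by (meson finite_subset image_mono order_trans)
    show "inj_on \<phi> C" using Suc.prems(3) C(1) by (rule inj_on_subset)
  qed (use nn Suc.prems(4) C(1) in auto)
  moreover have "chunked u' c (t - 240/959) (B' - \<phi> ` C)"
  proof (rule Suc.IH[OF C(3)])
    show "inj_on \<phi> (B - C)" using Suc.prems(3) by (rule inj_on_subset) auto
    show "\<phi> ` (B - C) \<subseteq> B' - \<phi> ` C" using Suc.prems(3,5) C(1) by (auto simp: inj_on_def)
  qed (use Suc.prems in auto)
  moreover have "\<phi> ` C \<subseteq> B'" using C Suc.prems(5) by auto
  ultimately show ?case using C(2) by (intro chunked_SucI[of "\<phi> ` C"]) auto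
qed

lemma chunked_mono:
  assumes "chunked u c t B" "finite B'" "\<And>g. 0 \<le> u g" "B \<subseteq> B'"
  shows "chunked u c t B'"
  by (rule chunked_image[OF assms(1,2,3), where \<phi> = id]) (use assms in auto)

text \<open>If \<open>g\<close> lies outside all chunks, \<open>C\<close> becomes a new chunk, whose
  nominal value 240/959 covers \<open>g\<close>. Otherwise \<open>C\<close> takes over from the
  chunk containing \<open>g\<close>.\<close>

lemma chunked_replace:
  assumes "chunked u c t B" "finite B" "g \<in> B" "u g \<le> 240/959" "C \<inter> B = {}" "finite C"
    "239/959 \<le> sum u C" and nn: "\<And>g. 0 \<le> u g"
  shows "\<exists>c'. chunked u c' t (B - {g} \<union> C)"
  using assms(1-7)
proof (induction c arbitrary: t B)
  case 0
  have "sum u B = u g + sum u (B - {g})" using 0 by (intro sum.remove) auto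
  then have "chunked u (Suc 0) t (B - {g} \<union> C)"
  proof -
    have "B - {g} \<union> C - C = B - {g}" using 0 by blast
    then show ?thesis using 0 \<open>sum u B = u g + sum u (B - {g})\<close> by (intro chunked_SucI[of C]) auto
  qed
  then show ?case by blast
next
  case (Suc c)
  then obtain D where D: "D \<subseteq> B" "239/959 \<le> sum u D" "chunked u c (t - 240/959) (B - D)" by auto
  show ?case
  proof (cases "g \<in> D")
    case True
    \<comment> \<open>The rest of the old chunk \<open>D\<close> merely enlarges the
      remainder.\<close>
    have "chunked u c (t - 240/959) (B - {g} \<union> C - C)"
      by (rule chunked_mono[OF D(3)]) (use Suc.prems True nn in auto)
    then have "chunked u (Suc c) t (B - {g} \<union> C)" using Suc.prems by (intro chunked_SucI[of C]) auto
    then show ?thesis by blast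
  next
    case False
    have "\<exists>c'. chunked u c' (t - 240/959) (B - D - {g} \<union> C)"
      by (rule Suc.IH[OF D(3)]) (use Suc.prems False in auto)
    then obtain c' where "chunked u c' (t - 240/959) (B - D - {g} \<union> C)" by blast
    moreover have "B - D - {g} \<union> C = (B - {g} \<union> C) - D" using D(1) Suc.prems(5) by blast
    ultimately have "chunked u (Suc c') t (B - {g} \<union> C)" using D False by (intro chunked_SucI[of D]) auto
    then show ?thesis by blast
  qed
qed

lemma chunked_value:
  assumes "chunked u c t B" "finite B" and nn: "\<And>g. 0 \<le> u g"
  shows "t - c / 959 \<le> sum u B" "c * (239/959) \<le> sum u B"
proof -
  have "t - c / 959 \<le> sum u B \<and> c * (239/959) \<le> sum u B" using assms(1,2)
  proof (induction c arbitrary: t B)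
    case 0
    then show ?case using nn by (simp add: sum_nonneg)
  next
    case (Suc c)
    then obtain C where C: "C \<subseteq> B" "239/959 \<le> sum u C" "chunked u c (t - 240/959) (B - C)" by auto
    have "sum u B = sum u (B - C) + sum u C" using C(1) Suc.prems(2) by (rule sum.subset_diff)
    moreover have "t - 240/959 - c / 959 \<le> sum u (B - C) \<and> c * (239/959) \<le> sum u (B - C)"
      using Suc.IH[OF C(3)] Suc.prems(2) by simp
    ultimately show ?case using C(2) by (simp add: field_simps)
  qed
  then show "t - c / 959 \<le> sum u B" "c * (239/959) \<le> sum u B" by auto
qed

lemma near_unit_value:
  assumes "near_unit u B" "finite B" "\<And>g. 0 \<le> u g"
  shows "956/959 \<le> sum u B"
proof -
  obtain c where c: "chunked u c 1 B" using assms(1) by (auto simp: near_unit_def)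
  note v = chunked_value[OF c assms(2,3)]
  show ?thesis
  proof (cases "c \<le> 3")
    case True
    then have "real c \<le> 3" by simp
    with v(1) show ?thesis by simp
  next
    case False
    then have "4 \<le> real c" by simp
    with v(2) show ?thesis by simp
  qed
qed

lemma near_unit_image:
  assumes "near_unit u B" "finite B'" "\<And>g. 0 \<le> u' g" "inj_on \<phi> B"
    "\<And>g. g \<in> B \<Longrightarrow> u g \<le> u' (\<phi> g)" "\<phi> ` B \<subseteq> B'"
  shows "near_unit u' B'"
proof -
  obtain c where "chunked u c 1 B" using assms(1) by (auto simp: near_unit_def)
  from chunked_image[OF this assms(2-6)] show ?thesis by (auto simp: near_unit_def)
qed

lemma near_unit_replace:
  assumes "near_unit u B" "finite B" "g \<in> B" "u g \<le> 240/959" "C \<inter> B = {}" "finite C"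
    "239/959 \<le> sum u C" "\<And>g. 0 \<le> u g"
  shows "near_unit u (B - {g} \<union> C)"
proof -
  obtain c where "chunked u c 1 B" using assms(1) by (auto simp: near_unit_def)
  from chunked_replace[OF this assms(2-8)] show ?thesis by (auto simp: near_unit_def)
qed

text \<open>Without chunks the rest is worth 1 - 720/959. A chunk avoiding \<open>g\<close> suffices
  by itself. If the chunk split off first contains \<open>g\<close>, then outside it there is either
  a second chunk or value at least 719/959.\<close>

lemma near_unit_remainder:
  assumes "near_unit u B" "finite B" "g \<in> B" "u g \<le> 720/959" and nn: "\<And>g. 0 \<le> u g"
  shows "239/959 \<le> sum u (B - {g})"
proof -
  obtain c where c: "chunked u c 1 B" using assms(1) by (auto simp: near_unit_def)
  have rem: "sum u B = u g + sum u (B - {g})" using assms by (intro sum.remove) auto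
  have sub: "239/959 \<le> sum u (B - {g})" if "239/959 \<le> sum u C" "C \<subseteq> B - {g}" for C
  proof -
    have "sum u C \<le> sum u (B - {g})" by (rule sum_mono2) (use that assms(2) nn in auto)
    with that show ?thesis by simp
  qed
  show ?thesis
  proof (cases c)
    case 0
    then show ?thesis using c rem assms(4) by simp
  next
    case (Suc c1)
    with c obtain C where C: "C \<subseteq> B" "239/959 \<le> sum u C" "chunked u c1 (1 - 240/959) (B - C)" by auto
    show ?thesis
    proof (cases "g \<in> C")
      case False
      then show ?thesis using sub[OF C(2)] C(1) by auto
    next
      case True
      have "239/959 \<le> sum u (B - C)"
      proof (cases c1)
        case 0
        then show ?thesis using C(3) by simp
      next
        case (Suc c2)
        with C(3) obtain D where D: "D \<subseteq> B - C" "239/959 \<le> sum u D" by auto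
        have "sum u D \<le> sum u (B - C)" by (rule sum_mono2) (use D assms(2) nn in auto)
        with D show ?thesis by simp
      qed
      then show ?thesis by (rule sub) (use True in auto)
    qed
  qed
qed

section \<open>Removing goods together with one bundle\<close>

definition splits :: "(nat \<Rightarrow> real) \<Rightarrow> nat \<Rightarrow> nat set \<Rightarrow> bool" where
  "splits u n G \<longleftrightarrow> (\<exists>B. (\<forall>b<n. B b \<subseteq> G \<and> near_unit u (B b)) \<and>
      (\<forall>a<n. \<forall>b<n. a \<noteq> b \<longrightarrow> B a \<inter> B b = {}))"

lemma splitsI:
  fixes J :: "nat set"
  assumes "finite J" "\<And>b. b \<in> J \<Longrightarrow> B b \<subseteq> G" "\<And>b. b \<in> J \<Longrightarrow> near_unit u (B b)"
    "\<And>a b. a \<in> J \<Longrightarrow> b \<in> J \<Longrightarrow> a \<noteq> b \<Longrightarrow> B a \<inter> B b = {}" "card J = n"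
  shows "splits u n G"
proof -
  obtain h where h: "bij_betw h {0..<n} J" using ex_bij_betw_nat_finite[OF assms(1)] assms(5) by blast
  have hJ: "h b \<in> J" if "b < n" for b using h that by (auto dest: bij_betwE)
  have "h a \<noteq> h b" if "a < n" "b < n" "a \<noteq> b" for a b using h that by (auto simp: bij_betw_def inj_on_def)
  then show ?thesis unfolding splits_def using assms(2-4) hJ by (intro exI[of _ "B \<circ> h"]) auto
qed

text \<open>Since \<open>splits\<close> asks only for disjointness, reductions may leave goods over.
  When a full partition is needed, these join bundle 0.\<close>

lemma splits_cover:
  assumes "splits u n G" "1 \<le> n" "finite G" and nn: "\<And>g. 0 \<le> u g"
  shows "\<exists>B. (\<forall>b<n. B b \<subseteq> G \<and> near_unit u (B b)) \<and>
    (\<forall>a<n. \<forall>b<n. a \<noteq> b \<longrightarrow> B a \<inter> B b = {}) \<and> (\<forall>g\<in>G. \<exists>b<n. g \<in> B b)"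
proof -
  obtain B where B0: "\<forall>b<n. B b \<subseteq> G \<and> near_unit u (B b)" "\<forall>a<n. \<forall>b<n. a \<noteq> b \<longrightarrow> B a \<inter> B b = {}"
    using assms(1) unfolding splits_def by (elim exE conjE)
  have B: "B b \<subseteq> G" "near_unit u (B b)" if "b < n" for b using B0(1) that by auto
  have dis: "B a \<inter> B b = {}" if "a < n" "b < n" "a \<noteq> b" for a b using B0(2) that by blast
  define R where "R = G - (\<Union>b<n. B b)"
  define B' where "B' b = (if b = 0 then B 0 \<union> R else B b)" for b
  show ?thesis
  proof (intro exI[of _ B'] conjI allI impI ballI)
    show "B' b \<subseteq> G" if "b < n" for b using B(1) that by (auto simp: B'_def R_def)
    show "near_unit u (B' b)" if "b < n" for b
    proof (rule near_unit_image[OF B(2)[OF that], where \<phi> = id])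
      show "finite (B' b)" using B(1) that assms(2,3) by (auto simp: B'_def R_def intro: finite_subset)
    qed (auto simp: nn B'_def)
    show "B' a \<inter> B' b = {}" if "a < n" "b < n" "a \<noteq> b" for a b
      using dis[OF that] that by (auto simp: B'_def R_def)
    show "\<exists>b<n. g \<in> B' b" if "g \<in> G" for g
    proof (cases "g \<in> R")
      case True
      then show ?thesis using assms(2) by (intro exI[of _ 0]) (simp add: B'_def)
    next
      case False
      then obtain b where "b < n" "g \<in> B b" using \<open>g \<in> G\<close> by (auto simp: R_def)
      then show ?thesis by (intro exI[of _ b]) (auto simp: B'_def)
    qed
  qed
qed

text \<open>By the pigeonhole principle some bundle contains \<open>j + 1\<close> of the first \<open>j * n + 1\<close> goods;
  exchanging them for the last \<open>j + 1\<close> of these goods does not harm the other bundles.\<close>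

lemma splits_remove_block:
  assumes sp: "splits u n {..<m}" and n: "1 \<le> n" and jm: "j * n < m"
    and anti: "\<And>a b. a \<le> b \<Longrightarrow> u b \<le> u a" and nn: "\<And>g. 0 \<le> u g"
  shows "splits u (n - 1) ({..<m} - {j * (n - 1)..j * n})"
proof -
  obtain B where B0: "\<forall>b<n. B b \<subseteq> {..<m} \<and> near_unit u (B b)"
      "\<forall>a<n. \<forall>b<n. a \<noteq> b \<longrightarrow> B a \<inter> B b = {}" "\<forall>g\<in>{..<m}. \<exists>b<n. g \<in> B b"
    using splits_cover[OF sp n finite_lessThan nn] by (elim exE conjE)
  have B: "B b \<subseteq> {..<m}" "near_unit u (B b)" if "b < n" for b using B0(1) that by auto
  have dis: "B a \<inter> B b = {}" if "a < n" "b < n" "a \<noteq> b" for a b using B0(2) that by blast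
  have cov: "\<exists>b<n. g \<in> B b" if "g \<in> {..<m}" for g using B0(3) that by blast
  define S where "S = {j * (n - 1)..j * n}"
  have jn: "j * n = j * (n - 1) + j" using n by (cases n) auto
  have cS: "card S = Suc j" using jn by (simp add: S_def)
  have "\<exists>b<n. Suc j \<le> card (B b \<inter> {..j * n})"
  proof (rule ccontr)
    assume no: "\<not> ?thesis"
    have "{..j * n} \<subseteq> (\<Union>b<n. B b \<inter> {..j * n})"
    proof
      fix g assume "g \<in> {..j * n}"
      moreover from this obtain b where "b < n" "g \<in> B b" using cov[of g] jm by auto
      ultimately show "g \<in> (\<Union>b<n. B b \<inter> {..j * n})" by blast
    qed
    then have "{..j * n} = (\<Union>b<n. B b \<inter> {..j * n})" by blast
    then have "Suc (j * n) = card (\<Union>b<n. B b \<inter> {..j * n})" using card_atMost[of "j * n"] by simp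
    also have "\<dots> \<le> (\<Sum>b<n. card (B b \<inter> {..j * n}))" by (rule card_UN_le) simp
    also have "\<dots> \<le> (\<Sum>b<n. j)" by (rule sum_mono) (use no in force)
    finally show False by simp
  qed
  then obtain b T where b: "b < n" and T: "T \<subseteq> B b \<inter> {..j * n}" "card T = Suc j"
    by (meson obtain_subset_with_card_n)
  have fT: "finite T" using T(1) finite_subset by blast
  have "card (S - T) = card (T - S)"
    using card_Diff_subset_Int[of S T] card_Diff_subset_Int[of T S] fT cS T(2)
    by (simp add: Int_commute)
  then obtain h where h: "bij_betw h (S - T) (T - S)"
    using finite_same_card_bij[of "S - T" "T - S"] fT by (auto simp: S_def)
  have hT: "h g \<in> T" "h g \<notin> S" if "g \<in> S - T" for g using h that by (auto dest: bij_betwE)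
  \<comment> \<open>The bundle \<open>B b\<close> containing \<open>T\<close> is dropped. Goods of
    \<open>S\<close> in other bundles are exchanged for goods of \<open>T - S\<close>, which precede
    all of \<open>S\<close> and so are worth at least as much.\<close>
  define \<phi> where "\<phi> g = (if g \<in> S - T then h g else g)" for g
  have inj: "inj_on \<phi> (- T)"
  proof (rule inj_onI)
    fix x y assume xy: "x \<in> - T" "y \<in> - T" "\<phi> x = \<phi> y"
    have "inj_on h (S - T)" using h by (simp add: bij_betw_def)
    then show "x = y" using xy hT(1)[of x] hT(1)[of y]
      by (cases "x \<in> S - T"; cases "y \<in> S - T") (auto simp: \<phi>_def dest: inj_onD)
  qed
  have outT: "B a \<subseteq> - T" if "a \<in> {..<n} - {b}" for a using dis[of a b] b T(1) that by blast
  show ?thesis unfolding S_def[symmetric]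
  proof (rule splitsI[of "{..<n} - {b}" "\<lambda>a. \<phi> ` B a"])
    show im: "\<phi> ` B a \<subseteq> {..<m} - S" if "a \<in> {..<n} - {b}" for a
    proof
      fix x assume "x \<in> \<phi> ` B a"
      then obtain g where g: "g \<in> B a" "x = \<phi> g" by blast
      have "g < m" "g \<notin> T" using B(1)[of a] outT[OF that] that g by auto
      moreover have "h g < m" if "g \<in> S - T" using hT(1)[OF that] T(1) jm by auto
      ultimately show "x \<in> {..<m} - S" using hT[of g] g by (auto simp: \<phi>_def)
    qed
    show "near_unit u (\<phi> ` B a)" if "a \<in> {..<n} - {b}" for a
    proof (rule near_unit_image[OF B(2)[of a], where \<phi> = \<phi>])
      show "finite (\<phi> ` B a)" using im[OF that] by (rule finite_subset) auto
      show "inj_on \<phi> (B a)" using inj outT[OF that] by (rule inj_on_subset)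
      show "u g \<le> u (\<phi> g)" for g
      proof (cases "g \<in> S - T")
        case True
        have "h g \<le> g" using hT[OF True] T(1) True by (auto simp: S_def)
        then show ?thesis using True anti by (simp add: \<phi>_def)
      qed (auto simp: \<phi>_def)
    qed (use that nn in auto)
    show "\<phi> ` B a \<inter> \<phi> ` B a' = {}" if "a \<in> {..<n} - {b}" "a' \<in> {..<n} - {b}" "a \<noteq> a'" for a a'
      using inj_on_image_Int[OF inj outT[OF that(1)] outT[OF that(2)]] dis[of a a'] that by simp
    show "card ({..<n} - {b}) = n - 1" using b by simp
  qed simp
qed

text \<open>The bundle of \<open>p\<close> is given up. If \<open>q\<close> lies in another bundle,
  the rest of the first bundle replaces it there as a chunk.\<close>

lemma splits_remove_pair:
  assumes sp: "splits u n {..<m}" and n: "1 \<le> n" and p: "p < m" "u p \<le> 720/959"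
    and q: "q < m" "u q \<le> 240/959" and pq: "p \<noteq> q" and nn: "\<And>g. 0 \<le> u g"
  shows "splits u (n - 1) ({..<m} - {p, q})"
proof -
  obtain B where B0: "\<forall>b<n. B b \<subseteq> {..<m} \<and> near_unit u (B b)"
      "\<forall>a<n. \<forall>b<n. a \<noteq> b \<longrightarrow> B a \<inter> B b = {}" "\<forall>g\<in>{..<m}. \<exists>b<n. g \<in> B b"
    using splits_cover[OF sp n finite_lessThan nn] by (elim exE conjE)
  have B: "B b \<subseteq> {..<m}" "near_unit u (B b)" if "b < n" for b using B0(1) that by auto
  have dis: "B a \<inter> B b = {}" if "a < n" "b < n" "a \<noteq> b" for a b using B0(2) that by blast
  have cov: "\<exists>b<n. g \<in> B b" if "g \<in> {..<m}" for g using B0(3) that by blast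
  obtain bp bq where bp: "bp < n" "p \<in> B bp" and bq: "bq < n" "q \<in> B bq" using cov p q by blast
  have fin: "finite (B b)" if "b < n" for b using B(1)[OF that] finite_subset by blast
  define B' where "B' b = (if b = bq \<and> bq \<noteq> bp then B bq - {q} \<union> (B bp - {p}) else B b)" for b
  have only: "b = bp" if "b < n" "p \<in> B b" for b using dis[of b bp] bp that by blast
  have onlyq: "b = bq" if "b < n" "q \<in> B b" for b using dis[of b bq] bq that by blast
  show ?thesis
  proof (rule splitsI[of "{..<n} - {bp}" B'])
    show "B' b \<subseteq> {..<m} - {p, q}" if "b \<in> {..<n} - {bp}" for b
      using that B(1)[of b] B(1)[OF bp(1)] only[of b] onlyq[of b] onlyq[of bp] bp(1)
      by (auto simp: B'_def split: if_splits)
    show "near_unit u (B' b)" if "b \<in> {..<n} - {bp}" for b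
    proof (cases "b = bq")
      case True
      have "near_unit u (B bq - {q} \<union> (B bp - {p}))"
      proof (rule near_unit_replace)
        show "(B bp - {p}) \<inter> B bq = {}" using dis[OF bp(1) bq(1)] that True by blast
        show "239/959 \<le> sum u (B bp - {p})"
          using near_unit_remainder[OF B(2)[OF bp(1)] fin[OF bp(1)] bp(2) p(2) nn] .
      qed (use B bq bp fin q nn in auto)
      then show ?thesis using that True by (simp add: B'_def)
    qed (use that B in \<open>auto simp: B'_def\<close>)
    show "B' a \<inter> B' b = {}" if "a \<in> {..<n} - {bp}" "b \<in> {..<n} - {bp}" "a \<noteq> b" for a b
      using that dis[of a b] dis[of a bp] dis[of b bp] dis[of a bq] dis[of b bq] bp(1) bq(1)
      by (auto simp: B'_def)
    show "card ({..<n} - {bp}) = n - 1" using bp by simp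
  qed simp
qed

lemma splits_relabel:
  assumes "splits u n (e ` {..<m})" "inj_on e {..<m}" "\<And>g. g < m \<Longrightarrow> u' g = u (e g)" "\<And>g. 0 \<le> u' g"
  shows "splits u' n {..<m}"
proof -
  obtain B where B0: "\<forall>b<n. B b \<subseteq> e ` {..<m} \<and> near_unit u (B b)" "\<forall>a<n. \<forall>b<n. a \<noteq> b \<longrightarrow> B a \<inter> B b = {}"
    using assms(1) unfolding splits_def by (elim exE conjE)
  have B: "B b \<subseteq> e ` {..<m}" "near_unit u (B b)" if "b < n" for b using B0(1) that by auto
  have dis: "B a \<inter> B b = {}" if "a < n" "b < n" "a \<noteq> b" for a b using B0(2) that by blast
  show ?thesis
  proof (rule splitsI[of "{..<n}" "\<lambda>b. {g \<in> {..<m}. e g \<in> B b}"])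
    show "near_unit u' {g \<in> {..<m}. e g \<in> B b}" if "b \<in> {..<n}" for b
    proof (rule near_unit_image[where u = u and B = "B b" and \<phi> = "inv_into {..<m} e"])
      have sub: "B b \<subseteq> e ` {..<m}" using B(1) that by simp
      show "inj_on (inv_into {..<m} e) (B b)" using sub by (rule inj_on_inv_into)
      have inv: "inv_into {..<m} e g < m" "e (inv_into {..<m} e g) = g" if "g \<in> B b" for g
        using sub that f_inv_into_f[of g e "{..<m}"] inv_into_into[of g e "{..<m}"] by auto
      show "u g \<le> u' (inv_into {..<m} e g)" if "g \<in> B b" for g
        using inv[OF that] assms(3) by simp
      show "inv_into {..<m} e ` B b \<subseteq> {g \<in> {..<m}. e g \<in> B b}" using inv by auto
      show "near_unit u (B b)" using B(2) that by simp
      show "0 \<le> u' g" for g by (rule assms(4))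
    qed simp
    show "{g \<in> {..<m}. e g \<in> B a} \<inter> {g \<in> {..<m}. e g \<in> B b} = {}"
      if "a \<in> {..<n}" "b \<in> {..<n}" "a \<noteq> b" for a b using dis[of a b] that by auto
  qed auto
qed

section \<open>Arbitrary instances\<close>

lemma ex_decreasing_enumeration:
  fixes f :: "'a \<Rightarrow> real"
  assumes "finite M"
  shows "\<exists>e. bij_betw e {..<card M} M \<and> (\<forall>i j. i \<le> j \<longrightarrow> j < card M \<longrightarrow> f (e j) \<le> f (e i))"
proof -
  obtain xs where xs: "set xs = M" "distinct xs" using finite_distinct_list[OF assms] by blast
  define ys where "ys = sort_key (\<lambda>x. - f x) xs"
  have ys: "set ys = M" "distinct ys" "sorted (map (\<lambda>x. - f x) ys)" using xs by (auto simp: ys_def)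
  then have len: "length ys = card M" using distinct_card by force
  have "bij_betw ((!) ys) {..<card M} M" using ys len by (intro bij_betw_nth) auto
  moreover have "f (ys ! j) \<le> f (ys ! i)" if "i \<le> j" "j < card M" for i j
    using sorted_nth_mono[OF ys(3), of i j] that len by simp
  ultimately show ?thesis by blast
qed

text \<open>Dividing each good by the value of its bundle, at least 956/959, makes all bundles worth
  exactly 1 but may spoil the order, so the goods are sorted again.\<close>

lemma ex_normalised_order:
  assumes sp: "splits u n {..<m}" and n: "1 \<le> n"
    and anti: "\<And>a b. a \<le> b \<Longrightarrow> u b \<le> u a" and nn: "\<And>g. 0 \<le> u g"
  shows "\<exists>w \<pi>. (\<forall>i j. i \<le> j \<longrightarrow> w j \<le> w i) \<and> (\<forall>g. 0 \<le> w g) \<and> (\<forall>g<m. \<pi> g < n) \<and>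
    (\<forall>j<n. sum w {g. g < m \<and> \<pi> g = j} = 1) \<and> (\<forall>g. w g \<le> 959/956 * u g)"
proof -
  obtain B where B0: "\<forall>b<n. B b \<subseteq> {..<m} \<and> near_unit u (B b)"
      "\<forall>a<n. \<forall>b<n. a \<noteq> b \<longrightarrow> B a \<inter> B b = {}" "\<forall>g\<in>{..<m}. \<exists>b<n. g \<in> B b"
    using splits_cover[OF sp n finite_lessThan nn] by (elim exE conjE)
  define l where "l g = (SOME b. b < n \<and> g \<in> B b)" for g
  have l: "l g < n" "g \<in> B (l g)" if "g < m" for g
    using someI_ex[of "\<lambda>b. b < n \<and> g \<in> B b"] B0(3) that by (auto simp: l_def)
  have Bl: "B b = {g. g < m \<and> l g = b}" if "b < n" for b
  proof
    show "B b \<subseteq> {g. g < m \<and> l g = b}"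
    proof
      fix g assume "g \<in> B b"
      moreover from this have "g < m" using B0(1) that by auto
      ultimately show "g \<in> {g. g < m \<and> l g = b}" using l[of g] B0(2) that by blast
    qed
  qed (use l in auto)
  define s where "s b = sum u (B b)" for b
  have s: "956/959 \<le> s b" if "b < n" for b
  proof -
    have "finite (B b)" using B0(1) that finite_subset by blast
    then show ?thesis using near_unit_value[of u "B b"] B0(1) that nn by (auto simp: s_def)
  qed
  define f where "f g = u g / s (l g)" for g
  have f_le: "f g \<le> 959/956 * u g" if "g < m" for g
  proof -
    have "u g / s (l g) \<le> u g / (956/959)"
      using s[OF l(1)[OF that]] nn by (intro divide_left_mono) auto
    then show ?thesis by (simp add: f_def)
  qed
  have f0: "0 \<le> f g" if "g < m" for g using s[OF l(1)[OF that]] nn by (simp add: f_def)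
  obtain e where e: "bij_betw e {..<m} {..<m}" and e_anti: "\<And>i j. i \<le> j \<Longrightarrow> j < m \<Longrightarrow> f (e j) \<le> f (e i)"
    using ex_decreasing_enumeration[of "{..<m}" f] by auto
  have em: "e k < m" if "k < m" for k using bij_betwE[OF e] that by auto
  have inj: "inj_on e {..<m}" and ran: "e ` {..<m} = {..<m}" using e by (auto simp: bij_betw_def)
  define w where "w k = (if k < m then f (e k) else 0)" for k
  show ?thesis
  proof (intro exI[of _ w] exI[of _ "\<lambda>k. l (e k)"] conjI allI impI)
    show "w j \<le> w i" if "i \<le> j" for i j using e_anti[OF that] f0 em that by (simp add: w_def)
    show "0 \<le> w g" for g using f0 em by (simp add: w_def)
    show "l (e g) < n" if "g < m" for g using l em that by blast
    show "sum w {g. g < m \<and> l (e g) = j} = 1" if j: "j < n" for j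
    proof -
      have im: "e ` {g. g < m \<and> l (e g) = j} = B j"
        unfolding Bl[OF j] using em ran by (auto simp: image_iff)
      have "sum w {g. g < m \<and> l (e g) = j} = (\<Sum>g\<in>{g. g < m \<and> l (e g) = j}. f (e g))"
        by (rule sum.cong) (auto simp: w_def)
      also have "\<dots> = sum f (e ` {g. g < m \<and> l (e g) = j})"
        using inj_on_subset[OF inj, of "{g. g < m \<and> l (e g) = j}"] by (subst sum.reindex) auto
      also have "\<dots> = (\<Sum>g\<in>B j. u g / s j)" unfolding im by (rule sum.cong) (auto simp: f_def Bl[OF j])
      also have "\<dots> = s j / s j" unfolding s_def by (rule sum_divide_distrib[symmetric])
      also have "\<dots> = 1" using s[OF j] by simp
      finally show ?thesis .
    qed
    show "w k \<le> 959/956 * u k" for k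
    proof (cases "k < m")
      case True
      \<comment> \<open>Sorting keeps the bound at each position: among the first
        \<open>k + 1\<close> goods of the new order, one had old position at least
        \<open>k\<close>.\<close>
      have "\<exists>i\<le>k. k \<le> e i"
      proof (rule ccontr)
        assume "\<not> ?thesis"
        then have "e ` {..k} \<subseteq> {..<k}" by force
        then have "card (e ` {..k}) \<le> k" using card_mono[of "{..<k}"] by fastforce
        moreover have "inj_on e {..k}" using True by (intro inj_on_subset[OF inj]) auto
        then have "card (e ` {..k}) = Suc k" by (simp add: card_image)
        ultimately show False by simp
      qed
      then obtain i where i: "i \<le> k" "k \<le> e i" by blast
      have "f (e k) \<le> f (e i)" using e_anti i True by simp
      also have "\<dots> \<le> 959/956 * u (e i)" using f_le em i True by simp
      also have "\<dots> \<le> 959/956 * u k" using anti[OF i(2)] by simp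
      finally show ?thesis using True by (simp add: w_def)
    qed (simp add: w_def nn)
  qed
qed

text \<open>Induction over the reductions. Each serves one agent with at most four goods, which
  preserves \<open>4 * n < m\<close>. When none applies, scaling by 959/956 turns 720/959 into the
  threshold 180/239 of the irreducible case.\<close>

lemma ordered_allocation:
  fixes u :: "nat \<Rightarrow> nat \<Rightarrow> real"
  assumes "finite N" "card N = n" "4 * n < m"
    and "\<And>i a b. i \<in> N \<Longrightarrow> a \<le> b \<Longrightarrow> u i b \<le> u i a" and "\<And>i g. i \<in> N \<Longrightarrow> 0 \<le> u i g"
    and "\<And>i. i \<in> N \<Longrightarrow> splits (u i) n {..<m}"
  shows "\<exists>A. (\<forall>i\<in>N. A i \<subseteq> {..<m}) \<and> (\<forall>i\<in>N. \<forall>j\<in>N. i \<noteq> j \<longrightarrow> A i \<inter> A j = {}) \<and>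
             (\<forall>i\<in>N. 720/959 \<le> sum (u i) (A i))"
  using assms
proof (induction n arbitrary: N m u)
  case 0
  then show ?case by auto
next
  case (Suc n')
  let ?n = "Suc n'"
  note fin = Suc.prems(1) and cardN = Suc.prems(2) and m = Suc.prems(3)
  note anti = Suc.prems(4) and nn = Suc.prems(5) and sp = Suc.prems(6)
  show ?case
  proof (cases "\<exists>S i0. i0 \<in> N \<and> S \<subseteq> {..<m} \<and> card S \<le> 4 \<and> 720/959 \<le> sum (u i0) S \<and>
      (\<forall>i\<in>N. splits (u i) n' ({..<m} - S))")
    case True
    then obtain S i0 where i0: "i0 \<in> N" and S: "S \<subseteq> {..<m}" "card S \<le> 4" "720/959 \<le> sum (u i0) S"
      and spS: "\<And>i. i \<in> N \<Longrightarrow> splits (u i) n' ({..<m} - S)" by blast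
    define m' where "m' = card ({..<m} - S)"
    have m': "m' = m - card S" using S(1) by (simp add: m'_def card_Diff_subset finite_subset)
    \<comment> \<open>The remaining goods are renumbered in their old order, so values stay
      decreasing.\<close>
    obtain e where e: "bij_betw e {..<m'} ({..<m} - S)" "strict_mono_on {..<m'} e"
      using ex_bij_betw_strict_mono_card[of "{..<m} - S"] unfolding m'_def by auto
    have ran: "e ` {..<m'} = {..<m} - S" and inj: "inj_on e {..<m'}" using e(1) by (auto simp: bij_betw_def)
    define u' where "u' i g = (if g < m' then u i (e g) else 0)" for i g
    have "\<exists>A. (\<forall>i\<in>N - {i0}. A i \<subseteq> {..<m'}) \<and> (\<forall>i\<in>N - {i0}. \<forall>j\<in>N - {i0}. i \<noteq> j \<longrightarrow> A i \<inter> A j = {}) \<and>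
             (\<forall>i\<in>N - {i0}. 720/959 \<le> sum (u' i) (A i))"
    proof (rule Suc.IH)
      show "finite (N - {i0})" "card (N - {i0}) = n'" using fin cardN i0 by auto
      show "4 * n' < m'" using m m' S(2) by simp
      show "u' i b \<le> u' i a" if "i \<in> N - {i0}" "a \<le> b" for i a b
      proof (cases "b < m'")
        case True
        then have "e a \<le> e b" using strict_mono_on_leD[OF e(2), of a b] that by auto
        then show ?thesis using True that anti by (simp add: u'_def)
      qed (use that nn in \<open>simp add: u'_def\<close>)
      show nn': "0 \<le> u' i g" if "i \<in> N - {i0}" for i g using that nn by (simp add: u'_def)
      show "splits (u' i) n' {..<m'}" if "i \<in> N - {i0}" for i
        by (rule splits_relabel[of "u i" n' e]) (use spS that ran inj nn'[OF that] in \<open>auto simp: u'_def\<close>)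
    qed
    then obtain A where A: "\<And>i. i \<in> N - {i0} \<Longrightarrow> A i \<subseteq> {..<m'}"
      "\<And>i j. i \<in> N - {i0} \<Longrightarrow> j \<in> N - {i0} \<Longrightarrow> i \<noteq> j \<Longrightarrow> A i \<inter> A j = {}"
      "\<And>i. i \<in> N - {i0} \<Longrightarrow> 720/959 \<le> sum (u' i) (A i)" by metis
    define A' where "A' i = (if i = i0 then S else e ` A i)" for i
    have eA: "e ` A i \<subseteq> {..<m} - S" if "i \<in> N - {i0}" for i using A(1)[OF that] ran by blast
    show ?thesis
    proof (intro exI[of _ A'] conjI ballI impI)
      show "A' i \<subseteq> {..<m}" if "i \<in> N" for i using eA[of i] S(1) that by (auto simp: A'_def)
      show "A' i \<inter> A' j = {}" if "i \<in> N" "j \<in> N" "i \<noteq> j" for i j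
      proof (cases "i = i0 \<or> j = i0")
        case True
        then show ?thesis using eA[of i] eA[of j] that by (auto simp: A'_def)
      next
        case False
        then have "e ` A i \<inter> e ` A j = e ` (A i \<inter> A j)"
          using inj_on_image_Int[OF inj, of "A i" "A j"] A(1)[of i] A(1)[of j] that by simp
        then show ?thesis using False A(2)[of i j] that by (simp add: A'_def)
      qed
      show "720/959 \<le> sum (u i) (A' i)" if "i \<in> N" for i
      proof (cases "i = i0")
        case True
        then show ?thesis using S(3) by (simp add: A'_def)
      next
        case False
        then have Ai: "A i \<subseteq> {..<m'}" using A(1) that by simp
        have "sum (u i) (e ` A i) = (\<Sum>g\<in>A i. u i (e g))"
          using inj_on_subset[OF inj Ai] by (subst sum.reindex) auto
        also have "\<dots> = sum (u' i) (A i)" using Ai by (intro sum.cong) (auto simp: u'_def)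
        finally show ?thesis using A(3)[of i] False that by (simp add: A'_def)
      qed
    qed
  next
    case False
    then have irr: "sum (u i) S < 720/959"
      if "i \<in> N" "S \<subseteq> {..<m}" "card S \<le> 4" "\<And>i. i \<in> N \<Longrightarrow> splits (u i) n' ({..<m} - S)" for i S
      using that by (meson not_le)
    have block: "sum (u i) {j * n'..j * ?n} < 720/959" if "i \<in> N" "j \<le> 3" for i j
    proof (rule irr[OF that(1)])
      have "j * ?n \<le> 3 * ?n" using that(2) by (rule mult_le_mono1)
      then have jm: "j * ?n < m" using m by simp
      then show "{j * n'..j * ?n} \<subseteq> {..<m}" by auto
      show "card {j * n'..j * ?n} \<le> 4" using that by simp
      show "splits (u i') n' ({..<m} - {j * n'..j * ?n})" if "i' \<in> N" for i'
        using splits_remove_block[OF sp[OF that] _ jm anti[OF that] nn[OF that]] by simp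
    qed
    have iv: "{n'..Suc n'} = {n', Suc n'}" "{2 * n'..2 * ?n} = {2 * n', Suc (2 * n'), Suc (Suc (2 * n'))}"
      "{3 * n'..3 * ?n} = {3 * n', Suc (3 * n'), Suc (Suc (3 * n')), Suc (Suc (Suc (3 * n')))}"
      by auto
    have b0: "u i 0 < 720/959" and b1: "u i n' + u i ?n < 720/959"
      and b2: "u i (2 * n') + u i (2 * n' + 1) + u i (2 * ?n) < 720/959"
      if "i \<in> N" for i
      using block[OF that, of 0] block[OF that, of 1] block[OF that, of 2] unfolding iv(2)
      by (simp_all add: iv(1))
    have n3: "3 * ?n = Suc (Suc (Suc (3 * n')))" by simp
    have b3: "u i (3 * n') + u i (3 * n' + 1) + u i (3 * n' + 2) + u i (3 * ?n) < 720/959" if "i \<in> N" for i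
      using block[OF that, of 3] unfolding iv(3) n3 by (simp add: add.assoc)
    have c2: "u i (2 * ?n) \<le> 240/959" if "i \<in> N" for i
      using b2[OF that] anti[OF that, of "2 * n'" "2 * ?n"] anti[OF that, of "2 * n' + 1" "2 * ?n"] by simp
    have b4: "u i 0 + u i (2 * ?n) < 720/959" if "i \<in> N" for i
    proof -
      have "sum (u i) {0, 2 * ?n} < 720/959"
      proof (rule irr[OF that])
        show "{0, 2 * ?n} \<subseteq> {..<m}" using m by simp
        show "card {0, 2 * ?n} \<le> 4" by simp
        show "splits (u i') n' ({..<m} - {0, 2 * ?n})" if "i' \<in> N" for i'
          using splits_remove_pair[OF sp[OF that], of 0 "2 * ?n"] b0[OF that] c2[OF that] nn[OF that] m by simp
      qed
      then show ?thesis by simp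
    qed
    have "\<exists>w \<pi>. ordered_agent ?n m w \<pi> \<and> (\<forall>g. w g \<le> 959/956 * u i g)" if i: "i \<in> N" for i
    proof -
      obtain w \<pi> where w: "\<forall>i j. i \<le> j \<longrightarrow> w j \<le> w i" "\<forall>g. 0 \<le> w g" "\<forall>g<m. \<pi> g < ?n"
        "\<forall>j<?n. sum w {g. g < m \<and> \<pi> g = j} = 1" "\<forall>g. w g \<le> 959/956 * u i g"
        using ex_normalised_order[OF sp[OF i] _ anti[OF i] nn[OF i]] by auto
      have "ordered_agent ?n m w \<pi>"
      proof
        have wu: "w g \<le> 959/956 * u i g" for g using w(5) by blast
        show "w (?n - 1) + w ?n < 180/239" using b1[OF i] wu[of n'] wu[of ?n] by simp
        show "w (2 * ?n - 2) + w (2 * ?n - 1) + w (2 * ?n) < 180/239"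
          using b2[OF i] wu[of "2 * n'"] wu[of "2 * n' + 1"] wu[of "2 * ?n"] by simp
        show "w (3 * ?n - 3) + w (3 * ?n - 2) + w (3 * ?n - 1) + w (3 * ?n) < 180/239"
          using b3[OF i] wu[of "3 * n'"] wu[of "3 * n' + 1"] wu[of "3 * n' + 2"] wu[of "3 * ?n"]
          by (simp add: numeral_3_eq_3)
        show "w 0 + w (2 * ?n) < 180/239" using b4[OF i] wu[of 0] wu[of "2 * ?n"] by simp
      qed (use w m in auto)
      with w(5) show ?thesis by blast
    qed
    then obtain w \<pi> where w: "\<And>i. i \<in> N \<Longrightarrow> ordered_agent ?n m (w i) (\<pi> i)"
      "\<And>i g. i \<in> N \<Longrightarrow> w i g \<le> 959/956 * u i g" by metis
    obtain h where h: "bij_betw h {..<?n} N"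
      using ex_bij_betw_nat_finite[OF fin] cardN by (auto simp: atLeast0LessThan)
    have hN: "h i \<in> N" if "i < ?n" for i using h that by (auto dest: bij_betwE)
    obtain A where A: "\<forall>i<?n. A i \<subseteq> {..<m}" "\<forall>i<?n. \<forall>j<?n. i \<noteq> j \<longrightarrow> A i \<inter> A j = {}"
      "\<forall>i<?n. 180/239 \<le> sum (w (h i)) (A i)"
      using irreducible_allocation[of ?n m "\<lambda>i. w (h i)" "\<lambda>i. \<pi> (h i)"] w(1) hN by auto
    define k where "k = inv_into {..<?n} h"
    have k: "k i < ?n" "h (k i) = i" if "i \<in> N" for i
      using bij_betw_inv_into_right[OF h that] bij_betwE[OF bij_betw_inv_into[OF h]] that by (auto simp: k_def)
    show ?thesis
    proof (intro exI[of _ "\<lambda>i. A (k i)"] conjI ballI impI)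
      show "A (k i) \<subseteq> {..<m}" if "i \<in> N" for i using A(1) k(1)[OF that] by blast
      show "A (k i) \<inter> A (k j) = {}" if "i \<in> N" "j \<in> N" "i \<noteq> j" for i j
      proof -
        have "k i \<noteq> k j" using k(2) that by metis
        then show ?thesis using A(2) k(1) that by blast
      qed
      show "720/959 \<le> sum (u i) (A (k i))" if "i \<in> N" for i
      proof -
        have "sum (w i) (A (k i)) \<le> 959/956 * sum (u i) (A (k i))"
          unfolding sum_distrib_left by (rule sum_mono) (rule w(2)[OF that])
        moreover have "180/239 \<le> sum (w i) (A (k i))" using A(3) k[OF that] by metis
        ultimately show ?thesis by simp
      qed
    qed
  qed
qed

text \<open>Passes from commonly ordered goods back to the actual ones: at turn \<open>k\<close>
  only \<open>k\<close> goods are gone, so one of the \<open>k + 1\<close> best goods of agent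
  \<open>p k\<close> is still there.\<close>

lemma picking_sequence:
  fixes v :: "nat \<Rightarrow> 'g \<Rightarrow> real" and e :: "nat \<Rightarrow> nat \<Rightarrow> 'g"
  assumes e: "\<And>k. k < m \<Longrightarrow> bij_betw (e (p k)) {..<m} M"
    and dec: "\<And>k i j. k < m \<Longrightarrow> i \<le> j \<Longrightarrow> j < m \<Longrightarrow> v (p k) (e (p k) j) \<le> v (p k) (e (p k) i)"
  shows "t \<le> m \<Longrightarrow> \<exists>f. inj_on f {..<t} \<and> f ` {..<t} \<subseteq> M \<and> (\<forall>k<t. v (p k) (e (p k) k) \<le> v (p k) (f k))"
proof (induction t)
  case 0
  then show ?case by auto
next
  case (Suc t)
  then obtain f where f: "inj_on f {..<t}" "f ` {..<t} \<subseteq> M" "\<forall>k<t. v (p k) (e (p k) k) \<le> v (p k) (f k)"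
    by auto
  have tm: "t < m" using Suc.prems by simp
  have inj: "inj_on (e (p t)) {..t}"
    using e[OF tm] tm by (auto simp: bij_betw_def intro: inj_on_subset)
  have "\<not> e (p t) ` {..t} \<subseteq> f ` {..<t}"
  proof
    assume "e (p t) ` {..t} \<subseteq> f ` {..<t}"
    then have "card (e (p t) ` {..t}) \<le> card (f ` {..<t})" by (intro card_mono) auto
    then show False using card_image[OF inj] card_image[OF f(1)] by simp
  qed
  then obtain i where i: "i \<le> t" "e (p t) i \<notin> f ` {..<t}" by blast
  have "e (p t) i \<in> M" using e[OF tm] i(1) tm by (auto simp: bij_betw_def)
  moreover have "v (p t) (e (p t) t) \<le> v (p t) (e (p t) i)" using dec[OF tm i(1) tm] .
  moreover have "f x \<noteq> e (p t) i" "e (p t) i \<noteq> f x" if "x < t" for x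
    using i(2) that by (metis imageI lessThan_iff)+
  ultimately show ?case using f
    by (intro exI[of _ "f(t := e (p t) i)"]) (auto simp: lessThan_Suc inj_on_def less_Suc_eq)
qed

section \<open>Maximin shares and the general case\<close>

lemma finite_partitions: "finite S \<Longrightarrow> finite (partitions d S)"
proof -
  assume S: "finite S"
  have "partitions d S \<subseteq> {P. \<forall>j. (j \<in> {..<d} \<longrightarrow> P j \<in> Pow S) \<and> (j \<notin> {..<d} \<longrightarrow> P j = {})}"
    by (auto simp: partitions_def)
  moreover have "finite {P. \<forall>j. (j \<in> {..<d} \<longrightarrow> P j \<in> Pow S) \<and> (j \<notin> {..<d} \<longrightarrow> P j = ({} :: 'a set))}"
    by (rule finite_set_of_finite_funs) (use S in auto)
  ultimately show ?thesis by (rule finite_subset)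
qed

lemma MMS_attained:
  assumes "finite S" "1 \<le> d"
  shows "\<exists>P\<in>partitions d S. (\<forall>j<d. MMS d v S \<le> additive_val v (P j)) \<and> (\<exists>j<d. MMS d v S = additive_val v (P j))"
proof -
  let ?F = "\<lambda>P. Min ((\<lambda>j. additive_val v (P j)) ` {..<d})"
  have "(\<lambda>j. if j = 0 then S else {}) \<in> partitions d S" using assms(2) by (auto simp: partitions_def)
  then have "MMS d v S \<in> ?F ` partitions d S"
    unfolding MMS_def using finite_partitions[OF assms(1), of d] by (intro Max_in) auto
  then obtain P where P: "P \<in> partitions d S" "MMS d v S = ?F P" by blast
  have ne: "finite ((\<lambda>j. additive_val v (P j)) ` {..<d})" "(\<lambda>j. additive_val v (P j)) ` {..<d} \<noteq> {}"
    using assms(2) by (auto simp: lessThan_empty_iff)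
  show ?thesis
  proof (intro bexI[OF _ P(1)] conjI allI impI)
    show "MMS d v S \<le> additive_val v (P j)" if "j < d" for j
      unfolding P(2) by (rule Min_le) (use ne that in auto)
    show "\<exists>j<d. MMS d v S = additive_val v (P j)" using Min_in[OF ne] P(2) by auto
  qed
qed

theorem theorem46:
  fixes n :: nat and M :: "'g set" and v :: "nat \<Rightarrow> 'g \<Rightarrow> real" and \<alpha> :: real
  assumes "n \<ge> 1"
    and "finite M"
    and "\<And>i g. i < n \<Longrightarrow> g \<in> M \<Longrightarrow> v i g \<ge> 0"
    and "\<alpha> \<le> 3/4 + 3/3836"
  shows "\<exists>A. alpha_MMS \<alpha> n M v A"
proof -
  define \<mu> where "\<mu> i = MMS n (v i) M" for i
  define c where "c = card M"
  have "\<forall>i. \<exists>P. P \<in> partitions n M \<and> (\<forall>j<n. \<mu> i \<le> additive_val (v i) (P j)) \<and>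
      (\<exists>j<n. \<mu> i = additive_val (v i) (P j))"
    using MMS_attained[OF assms(2,1)] unfolding \<mu>_def by blast
  from choice[OF this] obtain P where P0: "\<forall>i. P i \<in> partitions n M \<and>
      (\<forall>j<n. \<mu> i \<le> additive_val (v i) (P i j)) \<and> (\<exists>j<n. \<mu> i = additive_val (v i) (P i j))" ..
  then have P: "P i \<in> partitions n M" "j < n \<Longrightarrow> \<mu> i \<le> additive_val (v i) (P i j)"
    "\<exists>j<n. \<mu> i = additive_val (v i) (P i j)" for i j by auto
  have PM: "P i j \<subseteq> M" if "j < n" for i j using P(1)[of i] that by (auto simp: partitions_def)
  have Pdis: "P i j \<inter> P i k = {}" if "j < n" "k < n" "j \<noteq> k" for i j k
    using P(1)[of i] that by (auto simp: partitions_def)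
  have mu0: "0 \<le> \<mu> i" if i: "i < n" for i
  proof -
    obtain j where j: "j < n" "\<mu> i = additive_val (v i) (P i j)" using P(3) by blast
    show ?thesis unfolding j(2) additive_val_def
      by (rule sum_nonneg) (use assms(3)[OF i] PM[OF j(1)] in blast)
  qed
  have "\<forall>i. \<exists>e. bij_betw e {..<c} M \<and> (\<forall>a b. a \<le> b \<longrightarrow> b < c \<longrightarrow> v i (e b) \<le> v i (e a))"
    using ex_decreasing_enumeration[OF assms(2)] unfolding c_def by blast
  then obtain e where e: "\<And>i. bij_betw (e i) {..<c} M"
    and dec: "\<And>i a b. a \<le> b \<Longrightarrow> b < c \<Longrightarrow> v i (e i b) \<le> v i (e i a)" by metis
  have eM: "e i k \<in> M" if "k < c" for i k using bij_betwE[OF e] that by auto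
  \<comment> \<open>Agents with share 0 are content with nothing, and their values cannot be
    scaled.\<close>
  define N where "N = {i. i < n \<and> 0 < \<mu> i}"
  have N: "finite N" "card N \<le> n"
    using card_mono[of "{..<n}" N] by (auto simp: N_def)
  define u where "u i k = (if k < c then v i (e i k) / \<mu> i else 0)" for i k
  have u0: "0 \<le> u i k" if "i \<in> N" for i k using that assms(3) eM by (auto simp: u_def N_def)
  \<comment> \<open>Positions from \<open>c\<close> on are dummy goods of value 0, added to satisfy
    \<open>4 * card N < m\<close>.\<close>
  define m where "m = c + 4 * n + 1"
  have "\<exists>A. (\<forall>i\<in>N. A i \<subseteq> {..<m}) \<and> (\<forall>i\<in>N. \<forall>j\<in>N. i \<noteq> j \<longrightarrow> A i \<inter> A j = {}) \<and>
             (\<forall>i\<in>N. 720/959 \<le> sum (u i) (A i))"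
  proof (rule ordered_allocation[OF N(1) refl])
    show "4 * card N < m" using N(2) by (simp add: m_def)
    show "u i b \<le> u i a" if "i \<in> N" "a \<le> b" for i a b
      using dec[of a b i] u0[OF that(1), of a] that by (auto simp: u_def N_def divide_right_mono)
    show "0 \<le> u i g" if "i \<in> N" for i g using u0[OF that] .
    show "splits (u i) (card N) {..<m}" if i: "i \<in> N" for i
    \<comment> \<open>Of the \<open>n\<close> bundles of the maximin partition,
      \<open>card N\<close> suffice.\<close>
    proof (rule splitsI[of "{..<card N}" "\<lambda>b. {k. k < c \<and> e i k \<in> P i b}"])
      show "near_unit (u i) {k. k < c \<and> e i k \<in> P i b}" if "b \<in> {..<card N}" for b
      proof -
        have b: "b < n" using that N(2) by simp
        have inj: "inj_on (e i) {k. k < c \<and> e i k \<in> P i b}"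
          using e[of i] by (auto simp: bij_betw_def inj_on_def)
        have im: "e i ` {k. k < c \<and> e i k \<in> P i b} = P i b"
        proof
          show "P i b \<subseteq> e i ` {k. k < c \<and> e i k \<in> P i b}"
          proof
            fix g assume g: "g \<in> P i b"
            then have "g \<in> e i ` {..<c}" using PM[OF b] e[of i] by (auto simp: bij_betw_def)
            then show "g \<in> e i ` {k. k < c \<and> e i k \<in> P i b}" using g by auto
          qed
        qed auto
        have "sum (u i) {k. k < c \<and> e i k \<in> P i b} = (\<Sum>k\<in>{k. k < c \<and> e i k \<in> P i b}. v i (e i k)) / \<mu> i"
          by (simp add: sum_divide_distrib u_def)
        also have "(\<Sum>k\<in>{k. k < c \<and> e i k \<in> P i b}. v i (e i k)) = additive_val (v i) (P i b)"
          unfolding additive_val_def by (subst im[symmetric], subst sum.reindex[OF inj]) simp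
        also have "1 \<le> additive_val (v i) (P i b) / \<mu> i" using P(2)[OF b] i by (simp add: N_def)
        finally have "chunked (u i) 0 1 {k. k < c \<and> e i k \<in> P i b}" by simp
        then show ?thesis unfolding near_unit_def by blast
      qed
      show "{k. k < c \<and> e i k \<in> P i a} \<inter> {k. k < c \<and> e i k \<in> P i b} = {}"
        if "a \<in> {..<card N}" "b \<in> {..<card N}" "a \<noteq> b" for a b
        using Pdis[of a b i] that N(2) by auto
    qed (auto simp: m_def)
  qed
  then obtain A where A: "\<And>i. i \<in> N \<Longrightarrow> A i \<subseteq> {..<m}"
    "\<And>i j. i \<in> N \<Longrightarrow> j \<in> N \<Longrightarrow> i \<noteq> j \<Longrightarrow> A i \<inter> A j = {}"
    "\<And>i. i \<in> N \<Longrightarrow> 720/959 \<le> sum (u i) (A i)" by metis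
  \<comment> \<open>The owner of position \<open>k\<close> picks at turn \<open>k\<close>. Turns
    owned by nobody go to agent 0, who can only gain.\<close>
  define p where "p k = (if \<exists>i\<in>N. k \<in> A i then SOME i. i \<in> N \<and> k \<in> A i else 0)" for k
  have p: "p k = i" if "i \<in> N" "k \<in> A i" for i k
  proof -
    have "(SOME i. i \<in> N \<and> k \<in> A i) \<in> N \<and> k \<in> A (SOME i. i \<in> N \<and> k \<in> A i)"
      by (rule someI[of "\<lambda>i. i \<in> N \<and> k \<in> A i"]) (use that in blast)
    then have "(SOME i. i \<in> N \<and> k \<in> A i) = i" using A(2) that by blast
    then show ?thesis using that unfolding p_def by auto
  qed
  obtain f where f: "inj_on f {..<c}" "f ` {..<c} \<subseteq> M" "\<forall>k<c. v (p k) (e (p k) k) \<le> v (p k) (f k)"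
    using picking_sequence[of c e p M v c] e dec by auto
  define X where "X i = f ` {k. k < c \<and> p k = i}" for i
  have XM: "X i \<subseteq> M" for i using f(2) by (auto simp: X_def)
  show ?thesis
  proof (intro exI[of _ X], unfold alpha_MMS_def is_allocation_def, intro conjI allI impI)
    show "X i \<subseteq> M" for i by (rule XM)
    show "X i \<inter> X k = {}" if "i \<noteq> k" for i k
      using f(1) that by (auto simp: X_def inj_on_def)
    show "\<alpha> * MMS n (v i) M \<le> additive_val (v i) (X i)" if i: "i < n" for i
    proof (cases "i \<in> N")
      case True
      then have mu: "0 < \<mu> i" by (simp add: N_def)
      have sub: "A i \<inter> {..<c} \<subseteq> {k. k < c \<and> p k = i}" using p[OF True] by auto
      have "\<alpha> * \<mu> i \<le> 720/959 * \<mu> i" using assms(4) mu by (intro mult_right_mono) auto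
      also have "\<dots> \<le> sum (u i) (A i) * \<mu> i" using A(3)[OF True] mu by (intro mult_right_mono) auto
      also have "sum (u i) (A i) = sum (u i) (A i \<inter> {..<c})"
        by (rule sum.mono_neutral_right) (use A(1)[OF True] finite_subset in \<open>auto simp: u_def\<close>)
      also have "sum (u i) (A i \<inter> {..<c}) * \<mu> i = (\<Sum>k\<in>A i \<inter> {..<c}. v i (e i k))"
        unfolding sum_distrib_right by (rule sum.cong) (use mu in \<open>auto simp: u_def\<close>)
      also have "\<dots> \<le> (\<Sum>k\<in>{k. k < c \<and> p k = i}. v i (e i k))"
        by (rule sum_mono2) (use sub assms(3)[OF i] eM in auto)
      also have "\<dots> \<le> (\<Sum>k\<in>{k. k < c \<and> p k = i}. v i (f k))"
        by (rule sum_mono) (use f(3) in auto)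
      also have "\<dots> = additive_val (v i) (X i)"
        unfolding additive_val_def X_def
        using inj_on_subset[OF f(1), of "{k. k < c \<and> p k = i}"] by (subst sum.reindex) auto
      finally show ?thesis by (simp add: \<mu>_def)
    next
      case False
      then have "MMS n (v i) M = 0" using mu0[OF i] i by (auto simp: N_def \<mu>_def)
      moreover have "0 \<le> additive_val (v i) (X i)"
        unfolding additive_val_def by (rule sum_nonneg) (use assms(3)[OF i] XM in blast)
      ultimately show ?thesis by simp
    qed
  qed
qed

end
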